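(* Let $X$ be an infinite-dimensional complex Banach space and $T\in L(X)$. The following conditions are equivalent: (i) there exists a pair $(M,N)$ of closed $T$-invariant subspaces with $X=M\oplus N$ such that $T_M$ is surjective and $T_N$ is Riesz; (ii) $T$ admits a GKRD and $0\notin\operatorname{int}\sigma_{su}(T)$; (iii) $T$ admits a GKRD and the adjoint $T'$ has the SVEP at $0$; (iv) there exists a pair $(M,N)$ of closed $T$-invariant subspaces with $X=M\oplus N$ such that $T_M$ is lower semi-Browder and $T_N$ is Riesz; (v) $T$ admits a GKRD and $0\notin\operatorname{acc}\sigma_{\mathcal B_-}(T)$; (vi) $T$ admits a GKRD and $0\notin\operatorname{int}\sigma_{\mathcal B_-}(T)$; (vii) there exists a bounded projection $P$ on $X$ commuting with $T$ such that $T+P$ is lower semi-Browder and $TP$ is Riesz.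
   Context: $L(X)$ is the algebra of bounded operators on $X$. $S$ is Kato if $R(S)$ is closed and $N(S)\subset R(S^n)$ for all $n\in\mathbb N$. $S$ is Riesz if $S-\lambda$ is Fredholm for all $\lambda\ne0$. $S$ is lower semi-Fredholm if $\operatorname{codim}R(S)<\infty$, and lower semi-Browder if moreover it has finite descent. For closed $T$-invariant $M,N$ with $X=M\oplus N$, $T_M,T_N$ are the restrictions; $T$ admits a GKRD if there is such a pair with $T_M$ Kato and $T_N$ Riesz. $\sigma_{su}(T)=\{\lambda: T-\lambda \text{ not surjective}\}$, $\sigma_{\mathcal B_-}(T)=\{\lambda: T-\lambda\text{ not lower semi-Browder}\}$; $\operatorname{int}$, $\operatorname{acc}$ denote interior and accumulation points. An operator $S$ on a Banach space $Y$ has the SVEP at $\lambda_0$ if for every open disc $D$ centered at $\lambda_0$ the only analytic $f:D\to Y$ with $(S-\lambda)f(\lambda)=0$ on $D$ is $f\equiv0$. *)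

theory Defs
  imports "HOL-Analysis.Analysis"
begin

class complex_vector = real_vector +
  fixes scaleC :: "complex \<Rightarrow> 'a \<Rightarrow> 'a"  (infixr "*\<^sub>C" 75)
  assumes scaleR_scaleC: "r *\<^sub>R x = complex_of_real r *\<^sub>C x"
    and scaleC_add_right: "a *\<^sub>C (x + y) = a *\<^sub>C x + a *\<^sub>C y"
    and scaleC_add_left: "(a + b) *\<^sub>C x = a *\<^sub>C x + b *\<^sub>C x"
    and scaleC_scaleC: "a *\<^sub>C b *\<^sub>C x = (a * b) *\<^sub>C x"
    and scaleC_one: "1 *\<^sub>C x = x"

class complex_normed_vector = complex_vector + real_normed_vector +
  assumes norm_scaleC: "norm (a *\<^sub>C x) = cmod a * norm x"

definition csubspace :: "'a::complex_vector set \<Rightarrow> bool" where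
  "csubspace M \<longleftrightarrow> 0 \<in> M \<and> (\<forall>x\<in>M. \<forall>y\<in>M. x + y \<in> M) \<and> (\<forall>c. \<forall>x\<in>M. c *\<^sub>C x \<in> M)"

definition cspan :: "'a::complex_vector set \<Rightarrow> 'a set" where
  "cspan S = {x. \<exists>F c. finite F \<and> F \<subseteq> S \<and> x = (\<Sum>a\<in>F. c a *\<^sub>C a)}"

definition fin_cdim :: "'a::complex_vector set \<Rightarrow> bool" where
  "fin_cdim M \<longleftrightarrow> (\<exists>F. finite F \<and> F \<subseteq> M \<and> M \<subseteq> cspan F)"

definition fin_codim_in :: "'a::complex_vector set \<Rightarrow> 'a set \<Rightarrow> bool" where
  "fin_codim_in M R \<longleftrightarrow> (\<exists>F. finite F \<and> F \<subseteq> M \<and> M \<subseteq> {r + y |r y. r \<in> R \<and> y \<in> cspan F})"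

definition bop :: "('a::complex_normed_vector \<Rightarrow> 'a) \<Rightarrow> bool" where
  "bop T \<longleftrightarrow> bounded_linear T \<and> (\<forall>c x. T (c *\<^sub>C x) = c *\<^sub>C T x)"

definition shift :: "('a::complex_vector \<Rightarrow> 'a) \<Rightarrow> complex \<Rightarrow> 'a \<Rightarrow> 'a" where
  "shift S l = (\<lambda>x. S x - l *\<^sub>C x)"

definition kerM :: "('a::complex_vector \<Rightarrow> 'a) \<Rightarrow> 'a set \<Rightarrow> 'a set" where
  "kerM S M = {x \<in> M. S x = 0}"

definition fredholm_on :: "'a::complex_vector set \<Rightarrow> ('a \<Rightarrow> 'a) \<Rightarrow> bool" where
  "fredholm_on M S \<longleftrightarrow> fin_cdim (kerM S M) \<and> fin_codim_in M (S ` M)"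

definition riesz_on :: "'a::complex_vector set \<Rightarrow> ('a \<Rightarrow> 'a) \<Rightarrow> bool" where
  "riesz_on M S \<longleftrightarrow> (\<forall>l. l \<noteq> 0 \<longrightarrow> fredholm_on M (shift S l))"

definition kato_on :: "'a::complex_normed_vector set \<Rightarrow> ('a \<Rightarrow> 'a) \<Rightarrow> bool" where
  "kato_on M S \<longleftrightarrow> closed (S ` M) \<and> (\<forall>n. kerM S M \<subseteq> (S ^^ n) ` M)"

definition lower_semi_fredholm_on :: "'a::complex_vector set \<Rightarrow> ('a \<Rightarrow> 'a) \<Rightarrow> bool" where
  "lower_semi_fredholm_on M S \<longleftrightarrow> fin_codim_in M (S ` M)"

definition lower_semi_browder_on :: "'a::complex_vector set \<Rightarrow> ('a \<Rightarrow> 'a) \<Rightarrow> bool" where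
  "lower_semi_browder_on M S \<longleftrightarrow> lower_semi_fredholm_on M S \<and> (\<exists>d. (S ^^ d) ` M = (S ^^ Suc d) ` M)"

definition invariant_decomp :: "('a::complex_normed_vector \<Rightarrow> 'a) \<Rightarrow> 'a set \<Rightarrow> 'a set \<Rightarrow> bool" where
  "invariant_decomp T M N \<longleftrightarrow> csubspace M \<and> csubspace N \<and> closed M \<and> closed N \<and>
     T ` M \<subseteq> M \<and> T ` N \<subseteq> N \<and> M \<inter> N = {0} \<and> (\<forall>x. \<exists>m\<in>M. \<exists>n\<in>N. x = m + n)"

definition GKRD :: "('a::complex_normed_vector \<Rightarrow> 'a) \<Rightarrow> bool" where
  "GKRD T \<longleftrightarrow> (\<exists>M N. invariant_decomp T M N \<and> kato_on M T \<and> riesz_on N T)"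

definition sigma_su :: "('a::complex_vector \<Rightarrow> 'a) \<Rightarrow> complex set" where
  "sigma_su T = {l. \<not> surj (shift T l)}"

definition sigma_lsb :: "('a::complex_vector \<Rightarrow> 'a) \<Rightarrow> complex set" where
  "sigma_lsb T = {l. \<not> lower_semi_browder_on UNIV (shift T l)}"

definition dual_space :: "('a::complex_normed_vector \<Rightarrow>\<^sub>L complex) set" where
  "dual_space = {\<phi>. \<forall>c x. blinfun_apply \<phi> (c *\<^sub>C x) = c * blinfun_apply \<phi> x}"

definition adjoint :: "('a::complex_normed_vector \<Rightarrow> 'a) \<Rightarrow> ('a \<Rightarrow>\<^sub>L complex) \<Rightarrow> ('a \<Rightarrow>\<^sub>L complex)" where
  "adjoint T \<phi> = \<phi> o\<^sub>L Blinfun T"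

definition dscale :: "complex \<Rightarrow> ('a::real_normed_vector \<Rightarrow>\<^sub>L complex) \<Rightarrow> ('a \<Rightarrow>\<^sub>L complex)" where
  "dscale c \<phi> = blinfun_mult_left c o\<^sub>L \<phi>"

text \<open>f : D \<rightarrow> X' is analytic (complex differentiable in the norm of X' at every point of the open set D).\<close>
definition dual_analytic_on :: "complex set \<Rightarrow> (complex \<Rightarrow> ('a::complex_normed_vector \<Rightarrow>\<^sub>L complex)) \<Rightarrow> bool" where
  "dual_analytic_on D f \<longleftrightarrow> (\<forall>z\<in>D. f z \<in> dual_space) \<and>
     (\<forall>z\<in>D. \<exists>g. (f has_derivative (\<lambda>h. dscale h g)) (at z))"

definition adjoint_svep_at :: "('a::complex_normed_vector \<Rightarrow> 'a) \<Rightarrow> complex \<Rightarrow> bool" where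
  "adjoint_svep_at T z0 \<longleftrightarrow> (\<forall>r>0. \<forall>f. dual_analytic_on (ball z0 r) f \<and>
      (\<forall>l\<in>ball z0 r. adjoint T (f l) - dscale l (f l) = 0) \<longrightarrow> (\<forall>l\<in>ball z0 r. f l = 0))"

end

theory Submission
  imports Defs "HOL-Complex_Analysis.Cauchy_Integral_Formula"
begin

text \<open>
  Everything is reduced to the first condition. If T is Kato on M but not onto, a functional that
  annihilates T M can be lifted through T again and again, because the kernel lies in every
  T^n M; the resulting power series is an analytic family of non-zero functionals f(l)
  with f(l) annihilating (T - l) M near 0. Conversely, if (T - l0)^d M = (T - l0)^(d+1) M for a single
  point l0 of a disc, any such family vanishes on the disc: on (T - l0)^d M it has a zero of
  infinite order at l0. This dichotomy rules out the Kato case under each of the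
  conditions on the spectra and on the adjoint, and it also shows that for a Riesz operator the
  points of finite descent form a clopen subset of the punctured plane, hence all of it.
  Finally, a lower semi-Browder T on M splits as a surjective part on T^d M plus a finite-dimensional
  part, which is absorbed into the Riesz summand.
\<close>

section \<open>Open mapping and Hahn-Banach\<close>

text \<open>Restrictions are the same function read on a smaller set, so every tool is stated
  relative to a closed subspace. The functionals obtained from a Kato part that is not onto
  annihilate only (T - l) M, not (T - l) X, so conditions on T' or on the spectra of T do not apply
  to them directly. The bounded projection onto M along N closes this gap, because it commutes with
  T: composed with it, the functionals become eigenvectors of T', and through it finite descent of T
  - l0 on X passes to M. The assumption \<open>vanish\<close> of \<open>GKRD_imp_surj\<close>
  isolates what both uses share. On the Riesz part no compactness is available, only the Fredholm
  property of T - l for l \<noteq> 0; the clopen argument on the punctured plane takes its place and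
  is started at a large l, where a Neumann series makes T - l onto. The surjectivity spectrum needs
  no construction of its own in the direction towards a surjective part: it contains the lower
  semi-Browder spectrum, so a condition on its interior passes to the smaller set.\<close>

lemma approx_surj_imp_surj:
  fixes f :: "'a::banach \<Rightarrow> 'b::real_normed_vector"
  assumes f: "bounded_linear f" and S: "subspace S" "closed S"
    and q: "0 \<le> q" "q < 1" and C: "0 \<le> C"
    and approx: "\<And>y. y \<in> R \<Longrightarrow> \<exists>x\<in>S. norm x \<le> C * norm y \<and> y - f x \<in> R \<and> norm (y - f x) \<le> q * norm y"
    and y: "y \<in> R"
  shows "\<exists>x\<in>S. f x = y \<and> norm x \<le> C / (1 - q) * norm y"
proof -
  interpret f: bounded_linear f by fact
  obtain g where g: "\<And>y. y \<in> R \<Longrightarrow> g y \<in> S" "\<And>y. y \<in> R \<Longrightarrow> norm (g y) \<le> C * norm y"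
      "\<And>y. y \<in> R \<Longrightarrow> y - f (g y) \<in> R" "\<And>y. y \<in> R \<Longrightarrow> norm (y - f (g y)) \<le> q * norm y"
    using approx by metis
  \<comment> \<open>\<open>z n\<close> is the residual after n corrections and \<open>x n\<close>
    below is the correction of step n. The residuals decay like q^n, so the corrections sum up in
    the complete domain, with the geometric series giving the constant C / (1 - q).\<close>
  define z where "z = rec_nat y (\<lambda>_ u. u - f (g u))"
  have z0: "z 0 = y" and zS: "z (Suc n) = z n - f (g (z n))" for n
    by (simp_all add: z_def)
  have zR: "z n \<in> R" for n
    by (induction n) (use y g(3) zS z0 in auto)
  have zn: "norm (z n) \<le> q ^ n * norm y" for n
  proof (induction n)
    case (Suc n)
    have "norm (z (Suc n)) \<le> q * norm (z n)" using g(4) zR zS by simp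
    also have "\<dots> \<le> q * (q ^ n * norm y)" using Suc q by (intro mult_left_mono) auto
    finally show ?case by simp
  qed (simp add: z0)
  define x where "x = (\<lambda>n. g (z n))"
  have xn: "norm (x n) \<le> C * norm y * q ^ n" for n
  proof -
    have "norm (x n) \<le> C * norm (z n)" using g(2) zR x_def by simp
    also have "\<dots> \<le> C * (q ^ n * norm y)" using zn C by (intro mult_left_mono) auto
    finally show ?thesis by (simp add: mult_ac)
  qed
  have geo: "(\<lambda>n. C * norm y * q ^ n) sums (C * norm y * (1 / (1 - q)))"
    using q by (intro sums_mult geometric_sums) auto
  have sx: "summable (\<lambda>n. norm (x n))"
    using xn geo by (intro summable_comparison_test'[OF sums_summable[OF geo], of 0]) auto
  define u where "u = suminf x"
  have su: "x sums u" unfolding u_def using summable_norm_cancel[OF sx] by (rule summable_sums)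
  have "norm u \<le> (\<Sum>n. norm (x n))" unfolding u_def using sx by (rule summable_norm)
  also have "\<dots> \<le> C * norm y * (1 / (1 - q))"
    using suminf_le[OF xn sx sums_summable[OF geo]] sums_unique[OF geo] by simp
  finally have nu: "norm u \<le> C / (1 - q) * norm y" by (simp add: field_simps)
  have part: "f (\<Sum>i<n. x i) = y - z n" for n
    by (induction n) (auto simp: z0 zS x_def f.add f.zero)
  have "(\<lambda>n. f (\<Sum>i<n. x i)) \<longlonglongrightarrow> f u"
    using su f.tendsto unfolding sums_def by blast
  moreover have "z \<longlonglongrightarrow> 0"
  proof (rule Lim_null_comparison)
    show "\<forall>\<^sub>F n in sequentially. norm (z n) \<le> q ^ n * norm y" using zn by simp
    show "(\<lambda>n. q ^ n * norm y) \<longlonglongrightarrow> 0"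
      using q by (intro tendsto_mult_left_zero LIMSEQ_power_zero) auto
  qed
  then have "(\<lambda>n. y - z n) \<longlonglongrightarrow> y - 0" by (intro tendsto_intros)
  ultimately have "f u = y" using part LIMSEQ_unique by fastforce
  moreover have "u \<in> S"
  proof (rule closed_sequentially[OF S(2)])
    show "(\<lambda>n. \<Sum>i<n. x i) \<longlonglongrightarrow> u" using su by (simp add: sums_def)
    show "(\<Sum>i<n. x i) \<in> S" for n using g(1) zR x_def S by (intro subspace_sum) auto
  qed
  ultimately show ?thesis using nu by blast
qed

text \<open>Baire category is applied inside the closed range, which is completely metrizable: the
  closure of the image of some ball of \<open>S\<close> contains a relative ball. Differences of
  points in that image give approximate preimages with residual of half the size, and the iteration
  above makes them exact.\<close>

lemma open_mapping_subspace:
  fixes f :: "'a::banach \<Rightarrow> 'b::banach"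
  assumes f: "bounded_linear f" and S: "subspace S" "closed S" and R: "closed (f ` S)"
  obtains C where "C > 0" "\<And>y. y \<in> f ` S \<Longrightarrow> \<exists>x\<in>S. f x = y \<and> norm x \<le> C * norm y"
proof -
  interpret f: bounded_linear f by fact
  define R where "R = f ` S"
  have Rs: "subspace R" unfolding R_def using linear_subspace_image[OF f.linear_axioms S(1)] .
  define B where "B = (\<lambda>n::nat. f ` (S \<inter> cball 0 (real n)))"
  have BR: "B n \<subseteq> R" "closure (B n) \<subseteq> R" for n
    using R closure_minimal[of "B n" R] by (auto simp: B_def R_def)
  have "\<exists>n. top_of_set R interior_of (closure (B n)) \<noteq> {}"
  proof (rule ccontr)
    assume "\<not> ?thesis"
    then have "top_of_set R interior_of \<Union> (range (\<lambda>n. closure (B n))) = {}"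
    proof (intro Baire_category_alt)
      show "completely_metrizable_space (top_of_set R) \<or> locally_compact_space (top_of_set R) \<and> regular_space (top_of_set R)"
        using R completely_metrizable_space_closedin[OF completely_metrizable_space_euclidean, of R]
        by (simp add: R_def)
    qed (use \<open>\<not> _\<close> closed_subset[OF BR(2) closed_closure] in auto)
    moreover have "\<Union> (range (\<lambda>n. closure (B n))) = R"
    proof
      show "R \<subseteq> \<Union> (range (\<lambda>n. closure (B n)))"
      proof
        fix y assume "y \<in> R"
        then obtain x where "x \<in> S" "y = f x" by (auto simp: R_def)
        moreover obtain n where "norm x \<le> real n" using real_arch_simple by blast
        ultimately have "y \<in> B n" by (auto simp: B_def)
        then show "y \<in> \<Union> (range (\<lambda>n. closure (B n)))" using closure_subset by blast
      qed
    qed (use BR in blast)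
    moreover have "R \<noteq> {}" using Rs subspace_0 by blast
    ultimately show False
      by (metis interior_of_topspace topspace_euclidean_subtopology)
  qed
  then obtain n y0 where "y0 \<in> top_of_set R interior_of (closure (B n))" by blast
  then obtain U where "openin (top_of_set R) U" "y0 \<in> U" "U \<subseteq> closure (B n)"
    by (auto simp: interior_of_def)
  then obtain e where e: "e > 0" "ball y0 e \<inter> R \<subseteq> closure (B n)" "y0 \<in> R"
    unfolding openin_contains_ball by (meson order_trans subsetD)
  \<comment> \<open>A vector y is scaled by t = e / (2 |y|) to length e/2. The points y0 + t y and
    y0 are approximated within e/8 by images of vectors of norm at most n. Dividing by t turns the
    bound 2n for the difference of these vectors into (4n/e) |y|, and the total error e/4 into
    |y|/2.\<close>
  define K where "K = 4 * real n / e"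
  have step: "\<exists>x\<in>S. norm x \<le> K * norm y \<and> y - f x \<in> R \<and> norm (y - f x) \<le> 1/2 * norm y" if y: "y \<in> R" for y
  proof (cases "y = 0")
    case True
    then show ?thesis using S subspace_0 y by (intro bexI[of _ 0]) (auto simp: f.zero)
  next
    case False
    define t where "t = e / (2 * norm y)"
    have t: "t > 0" using e False by (simp add: t_def)
    have ty: "t *\<^sub>R y \<in> R" using y Rs subspace_scale by blast
    have "norm (t *\<^sub>R y) = e / 2" using False e by (simp add: t_def)
    then have "y0 + t *\<^sub>R y \<in> ball y0 e" using e by (simp add: dist_norm)
    moreover have "y0 + t *\<^sub>R y \<in> R" using ty e Rs subspace_add by blast
    ultimately have c1: "y0 + t *\<^sub>R y \<in> closure (B n)" using e by blast
    have c2: "y0 \<in> closure (B n)" using e by auto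
    define \<delta> where "\<delta> = e / 8"
    have d: "\<delta> > 0" using e by (simp add: \<delta>_def)
    obtain b1 b2 where b: "b1 \<in> B n" "dist b1 (y0 + t *\<^sub>R y) < \<delta>" "b2 \<in> B n" "dist b2 y0 < \<delta>"
      using c1 c2 d unfolding closure_approachable by blast
    then obtain x1 x2 where x: "x1 \<in> S" "b1 = f x1" "norm x1 \<le> n" "x2 \<in> S" "b2 = f x2" "norm x2 \<le> n"
      by (auto simp: B_def)
    define x where "x = (1/t) *\<^sub>R (x1 - x2)"
    have xS: "x \<in> S" unfolding x_def using x S subspace_diff subspace_scale by blast
    have "norm x = norm (x1 - x2) / t" using t by (simp add: x_def)
    also have "\<dots> \<le> (real n + real n) / t"
      using x norm_triangle_ineq4[of x1 x2] t by (intro divide_right_mono) auto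
    also have "\<dots> = K * norm y" using e False by (simp add: K_def t_def field_simps)
    finally have nx: "norm x \<le> K * norm y" .
    have "y - f x = (1/t) *\<^sub>R (t *\<^sub>R y - (b1 - b2))"
      using t x by (simp add: x_def f.scaleR f.diff scaleR_diff_right)
    then have "norm (y - f x) = norm (t *\<^sub>R y - (b1 - b2)) / t" using t by simp
    also have "\<dots> \<le> (\<delta> + \<delta>) / t"
    proof (rule divide_right_mono)
      have e: "t *\<^sub>R y - (b1 - b2) = (b2 - y0) - (b1 - (y0 + t *\<^sub>R y))" by simp
      show "norm (t *\<^sub>R y - (b1 - b2)) \<le> \<delta> + \<delta>"
        unfolding e using b norm_triangle_ineq4[of "b2 - y0" "b1 - (y0 + t *\<^sub>R y)"] unfolding dist_norm by linarith
    qed (use t in simp)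
    also have "\<dots> = 1/2 * norm y" using e False by (simp add: \<delta>_def t_def field_simps)
    finally have "norm (y - f x) \<le> 1/2 * norm y" .
    moreover have "y - f x \<in> R" using y xS Rs by (auto simp: R_def intro: subspace_diff)
    ultimately show ?thesis using nx xS by blast
  qed
  have K0: "K \<ge> 0" using e by (simp add: K_def)
  \<comment> \<open>The iteration yields K / (1 - 1/2) = 2K, which is 0 when n = 0; adding 1 keeps
    the constant positive.\<close>
  show thesis
  proof (rule that[of "2 * K + 1"])
    show "2 * K + 1 > 0" using K0 by simp
    fix y assume "y \<in> f ` S"
    then obtain x where x: "x \<in> S" "f x = y" "norm x \<le> K / (1 - 1/2) * norm y"
      using approx_surj_imp_surj[OF f S _ _ K0 step] by (fastforce simp: R_def)
    moreover have "K / (1 - 1/2) * norm y \<le> (2 * K + 1) * norm y"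
      by (intro mult_right_mono) auto
    ultimately show "\<exists>x\<in>S. f x = y \<and> norm x \<le> (2 * K + 1) * norm y" by force
  qed
qed

section \<open>The Hahn-Banach theorem for real functionals\<close>

lemma hahn_banach_real:
  fixes f :: "'a::real_normed_vector \<Rightarrow> real"
  assumes M: "subspace M"
    and add: "\<And>x y. x \<in> M \<Longrightarrow> y \<in> M \<Longrightarrow> f (x + y) = f x + f y"
    and sc: "\<And>c x. x \<in> M \<Longrightarrow> f (c *\<^sub>R x) = c * f x"
    and bd: "\<And>x. x \<in> M \<Longrightarrow> f x \<le> C * norm x" and C: "C \<ge> 0"
  obtains g where "bounded_linear g" "\<And>x. x \<in> M \<Longrightarrow> g x = f x" "\<And>x. \<bar>g x\<bar> \<le> C * norm x"
proof -
  \<comment> \<open>Partial functionals are represented by their graphs; the bound makes such a graph single-valued.\<close>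
  define \<G> where "\<G> = {G :: ('a \<times> real) set. subspace G \<and> (\<forall>p\<in>G. snd p \<le> C * norm (fst p)) \<and> (\<lambda>x. (x, f x)) ` M \<subseteq> G}"
  define G0 where "G0 = (\<lambda>x. (x, f x)) ` M"
  have f0: "f 0 = 0" using sc[of 0 0] subspace_0[OF M] by simp
  have "subspace G0"
  proof (rule subspaceI)
    show "0 \<in> G0" using subspace_0[OF M] f0 unfolding G0_def by (force simp: zero_prod_def)
    show "u + v \<in> G0" if "u \<in> G0" "v \<in> G0" for u v
      using that add M unfolding G0_def by (force simp: subspace_add)
    show "c *\<^sub>R u \<in> G0" if "u \<in> G0" for c u
      using that sc M unfolding G0_def by (force simp: subspace_scale)
  qed
  then have "G0 \<in> \<G>" using bd by (auto simp: \<G>_def G0_def)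
  moreover have "\<Union>\<C> \<in> \<G>" if ne: "\<C> \<noteq> {}" and ch: "subset.chain \<G> \<C>" for \<C>
  proof -
    have ch': "\<And>X. X \<in> \<C> \<Longrightarrow> X \<in> \<G>" "\<And>X Y. X \<in> \<C> \<Longrightarrow> Y \<in> \<C> \<Longrightarrow> X \<subseteq> Y \<or> Y \<subseteq> X"
      using ch by (auto simp: subset_chain_def)
    have sub: "\<And>X. X \<in> \<C> \<Longrightarrow> subspace X" using ch'(1) by (auto simp: \<G>_def)
    have "subspace (\<Union>\<C>)"
    proof (rule subspaceI)
      show "0 \<in> \<Union>\<C>" using ne sub subspace_0 by blast
      show "u + v \<in> \<Union>\<C>" if "u \<in> \<Union>\<C>" "v \<in> \<Union>\<C>" for u v
      proof -
        from that obtain X Y where XY: "X \<in> \<C>" "Y \<in> \<C>" "u \<in> X" "v \<in> Y" by blast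
        with ch'(2) obtain Z where "Z \<in> \<C>" "u \<in> Z" "v \<in> Z" by blast
        then show ?thesis using sub subspace_add by blast
      qed
      show "c *\<^sub>R u \<in> \<Union>\<C>" if "u \<in> \<Union>\<C>" for c u using that sub subspace_scale by blast
    qed
    then show ?thesis using ne ch'(1) unfolding \<G>_def by blast
  qed
  ultimately obtain G where G: "G \<in> \<G>" and max: "\<And>X. X \<in> \<G> \<Longrightarrow> G \<subseteq> X \<Longrightarrow> X = G"
    using subset_Zorn_nonempty[of \<G>] by (metis empty_iff)
  have Gs: "subspace G" and Gb: "\<And>x a. (x, a) \<in> G \<Longrightarrow> a \<le> C * norm x" and GM: "\<And>x. x \<in> M \<Longrightarrow> (x, f x) \<in> G"
    using G by (auto simp: \<G>_def)
  have Gadd: "(x + y, a + b) \<in> G" if "(x, a) \<in> G" "(y, b) \<in> G" for x y a b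
    using subspace_add[OF Gs that] by simp
  have Gsc: "(c *\<^sub>R x, c * a) \<in> G" if "(x, a) \<in> G" for c x a
    using subspace_scale[OF Gs that, of c] by simp
  have Gdiff: "(x - y, a - b) \<in> G" if "(x, a) \<in> G" "(y, b) \<in> G" for x y a b
    using subspace_diff[OF Gs that] by simp
  have uniq: "a = b" if "(x, a) \<in> G" "(x, b) \<in> G" for x a b
    using Gb[OF Gdiff[OF that]] Gb[OF Gdiff[OF that(2) that(1)]] by simp
  have dom: "\<exists>a. (x, a) \<in> G" for x
  proof (rule ccontr)
    assume nx: "\<nexists>a. (x, a) \<in> G"
    \<comment> \<open>A value a at x has to satisfy b - C |y - x| \<le> a \<le> C |z + x| - c for
      all (y, b) and (z, c) in the graph. This inequality makes the two sides compatible; the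
      supremum of the left sides is then a valid choice.\<close>
    have le: "b - C * norm (y - x) \<le> C * norm (z + x) - c" if "(y, b) \<in> G" "(z, c) \<in> G" for y b z c
    proof -
      have "b + c \<le> C * norm (y + z)" using Gb Gadd that by blast
      also have "\<dots> \<le> C * (norm (y - x) + norm (z + x))"
        using norm_triangle_ineq[of "y - x" "z + x"] C by (intro mult_left_mono) (auto simp: algebra_simps)
      finally show ?thesis by (simp add: algebra_simps)
    qed
    define L where "L = {b - C * norm (y - x) | y b. (y, b) \<in> G}"
    define a where "a = Sup L"
    have G00: "(0, 0) \<in> G" using subspace_0[OF Gs] by (simp add: zero_prod_def)
    have Lne: "L \<noteq> {}" using G00 by (auto simp: L_def)
    have Lbd: "bdd_above L"
      unfolding bdd_above_def L_def using le[OF _ G00] by (intro exI[of _ "C * norm (0 + x) - 0"]) auto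
    have lo: "b - C * norm (y - x) \<le> a" if "(y, b) \<in> G" for y b
      unfolding a_def by (rule cSup_upper[OF _ Lbd]) (use that in \<open>auto simp: L_def\<close>)
    have hi: "a \<le> C * norm (z + x) - c" if "(z, c) \<in> G" for z c
      unfolding a_def by (rule cSup_least[OF Lne]) (use le that in \<open>auto simp: L_def\<close>)
    define H where "H = {u + v | u v. u \<in> G \<and> v \<in> span {(x, a)}}"
    have "H \<in> \<G>"
      unfolding \<G>_def mem_Collect_eq
    proof (intro conjI ballI)
      show "subspace H" unfolding H_def by (rule subspace_sums[OF Gs subspace_span])
      show "(\<lambda>x. (x, f x)) ` M \<subseteq> H"
      proof -
        have "G \<subseteq> H"
        proof
          fix p assume "p \<in> G"
          then have "p + 0 \<in> H" unfolding H_def using span_zero by blast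
          then show "p \<in> H" by simp
        qed
        then show ?thesis using GM by blast
      qed
      fix p assume "p \<in> H"
      then obtain y b t where yb: "(y, b) \<in> G" and p: "p = (y + t *\<^sub>R x, b + t * a)"
        unfolding H_def span_singleton by fastforce
      \<comment> \<open>For t \<noteq> 0, division by |t| reduces the claim to \<open>hi\<close>
        when t > 0 and to \<open>lo\<close> when t < 0.\<close>
      have "b + t * a \<le> C * norm (y + t *\<^sub>R x)"
      proof (cases t "0::real" rule: linorder_cases)
        case equal then show ?thesis using Gb yb by simp
      next
        case greater
        have "a \<le> C * norm ((1/t) *\<^sub>R y + x) - (1/t) * b" using hi[OF Gsc[OF yb]] .
        then have "t * a \<le> t * (C * norm ((1/t) *\<^sub>R y + x) - (1/t) * b)"
          using greater by (intro mult_left_mono) auto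
        also have "\<dots> = C * (t * norm ((1/t) *\<^sub>R y + x)) - b" using greater by (simp add: algebra_simps)
        also have "t * norm ((1/t) *\<^sub>R y + x) = norm (t *\<^sub>R ((1/t) *\<^sub>R y + x))" using greater by simp
        also have "t *\<^sub>R ((1/t) *\<^sub>R y + x) = y + t *\<^sub>R x" using greater by (simp add: scaleR_add_right)
        finally show ?thesis by simp
      next
        case less
        define s where "s = - t"
        have s: "s > 0" "t = - s" using less by (auto simp: s_def)
        have "(1/s) * b - C * norm ((1/s) *\<^sub>R y - x) \<le> a" using lo[OF Gsc[OF yb]] .
        then have "s * ((1/s) * b - C * norm ((1/s) *\<^sub>R y - x)) \<le> s * a"
          using s by (intro mult_left_mono) auto
        also have "s * ((1/s) * b - C * norm ((1/s) *\<^sub>R y - x)) = b - C * (s * norm ((1/s) *\<^sub>R y - x))"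
          using s by (simp add: algebra_simps)
        also have "s * norm ((1/s) *\<^sub>R y - x) = norm (s *\<^sub>R ((1/s) *\<^sub>R y - x))" using s by simp
        also have "s *\<^sub>R ((1/s) *\<^sub>R y - x) = y - s *\<^sub>R x" using s by (simp add: scaleR_diff_right)
        finally show ?thesis using s by simp
      qed
      then show "snd p \<le> C * norm (fst p)" by (simp add: p)
    qed
    moreover have "G \<subseteq> H"
    proof
      fix p assume "p \<in> G"
      then have "p + 0 \<in> H" unfolding H_def using span_zero by blast
      then show "p \<in> H" by simp
    qed
    ultimately have HG: "H = G" using max by blast
    have "(0, 0) + (x, a) \<in> H" unfolding H_def using G00 span_base[of "(x, a)" "{(x, a)}"] by blast
    then have "(x, a) \<in> H" by simp
    then show False using nx HG by blast
  qed
  define g where "g = (\<lambda>x. THE a. (x, a) \<in> G)"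
  have gG: "(x, g x) \<in> G" for x
    unfolding g_def using dom[of x] uniq theI[of "\<lambda>a. (x, a) \<in> G"] by metis
  have gu: "g x = a" if "(x, a) \<in> G" for x a using uniq gG that by blast
  have gadd: "g (x + y) = g x + g y" for x y using gu Gadd gG by blast
  have gsc: "g (c *\<^sub>R x) = c * g x" for c x using gu Gsc gG by blast
  have gb: "\<bar>g x\<bar> \<le> C * norm x" for x
    using Gb[OF gG[of x]] Gb[OF Gsc[OF gG[of x], of "-1"]] by simp
  show thesis
  proof (rule that)
    show "bounded_linear g"
      using gadd gsc gb by (intro bounded_linear_intro[of g C]) (auto simp: mult.commute)
  qed (use gu GM gb in auto)
qed

section \<open>Complex subspaces and bounded operators\<close>

global_interpretation cvec: vector_space "scaleC :: complex \<Rightarrow> 'a \<Rightarrow> 'a::complex_vector"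
  by unfold_locales (simp_all add: scaleC_add_right scaleC_add_left scaleC_scaleC scaleC_one)

lemma csubspace_iff: "csubspace M \<longleftrightarrow> cvec.subspace M"
  by (auto simp: csubspace_def cvec.subspace_def)

lemma cspan_eq: "cspan S = cvec.span S"
  unfolding cspan_def cvec.span_explicit by auto

lemma csubspace_imp_subspace: "cvec.subspace M \<Longrightarrow> subspace (M :: 'a::complex_vector set)"
  by (auto simp: cvec.subspace_def subspace_def scaleR_scaleC)

lemma fin_codim_in_iff:
  "cvec.subspace R \<Longrightarrow> fin_codim_in M R \<longleftrightarrow> (\<exists>F. finite F \<and> F \<subseteq> M \<and> M \<subseteq> cvec.span (R \<union> F))"
  unfolding fin_codim_in_def cspan_eq cvec.span_Un cvec.span_eq_iff[of R, symmetric] by (simp only:)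

lemma fin_cdim_iff: "fin_cdim M \<longleftrightarrow> (\<exists>F. finite F \<and> F \<subseteq> M \<and> M \<subseteq> cvec.span F)"
  by (simp add: fin_cdim_def cspan_eq)

lemma bounded_linear_scaleC: "bounded_linear (\<lambda>x::'a::complex_normed_vector. c *\<^sub>C x)"
  by (rule bounded_linear_intro[of _ "cmod c"])
    (simp_all add: scaleC_add_right scaleR_scaleC scaleC_scaleC norm_scaleC mult.commute)

lemma bop_bl: "bop T \<Longrightarrow> bounded_linear T"
  and bop_scaleC: "bop T \<Longrightarrow> T (c *\<^sub>C x) = c *\<^sub>C T x"
  by (simp_all add: bop_def)

lemma bop_add: "bop T \<Longrightarrow> T (x + y) = T x + T y"
  and bop_diff: "bop T \<Longrightarrow> T (x - y) = T x - T y"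
  and bop_0: "bop T \<Longrightarrow> T 0 = 0"
  by (simp_all add: bop_def bounded_linear.linear linear_add linear_diff linear_0)

lemma bop_module_hom: "bop T \<Longrightarrow> module_hom scaleC scaleC T"
  by unfold_locales (simp_all add: bop_add bop_scaleC)

lemma bop_span_image: "bop T \<Longrightarrow> T ` cvec.span F = cvec.span (T ` F)"
  using module_hom.span_image[OF bop_module_hom] by metis

lemma bop_subspace_image: "bop T \<Longrightarrow> cvec.subspace M \<Longrightarrow> cvec.subspace (T ` M)"
  using module_hom.subspace_image[OF bop_module_hom] by metis

lemma bop_compose: "bop S \<Longrightarrow> bop T \<Longrightarrow> bop (S \<circ> T)"
  unfolding bop_def using bounded_linear_compose[of S T] by (simp add: o_def)

lemma bop_ident: "bop (\<lambda>x. x)"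
  by (simp add: bop_def bounded_linear_ident)

lemma bop_pow: "bop T \<Longrightarrow> bop (T ^^ n)"
proof (induction n)
  case 0 show ?case using bounded_linear_ident by (simp add: bop_def id_def)
next
  case (Suc n) then show ?case using bop_compose[of T "T ^^ n"] by (simp add: o_def)
qed

lemma bop_minus: "bop S \<Longrightarrow> bop T \<Longrightarrow> bop (\<lambda>x. S x - T x)"
  unfolding bop_def using bounded_linear_sub by (auto simp: cvec.scale_right_diff_distrib)

lemma bop_plus: "bop S \<Longrightarrow> bop T \<Longrightarrow> bop (\<lambda>x. S x + T x)"
  unfolding bop_def using bounded_linear_add by (auto simp: scaleC_add_right)

lemma bop_scale: "bop (\<lambda>x. c *\<^sub>C x)"
  unfolding bop_def using bounded_linear_scaleC by (auto simp: mult.commute)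

lemma bop_shift: "bop T \<Longrightarrow> bop (shift T l)"
  unfolding shift_def by (rule bop_minus[OF _ bop_scale])

lemma pow_invariant: "T ` M \<subseteq> M \<Longrightarrow> x \<in> M \<Longrightarrow> (T ^^ n) x \<in> M"
  by (induction n) auto

lemma shift_invariant: "cvec.subspace M \<Longrightarrow> T ` M \<subseteq> M \<Longrightarrow> shift T l ` M \<subseteq> M"
  by (auto simp: shift_def intro!: cvec.subspace_diff cvec.subspace_scale)

lemma shift_shift: "shift (shift T l) m = shift T (l + m)"
  by (auto simp: shift_def scaleC_add_left)

lemma shift_0: "shift T 0 = T"
  by (simp add: shift_def)

lemma pow_commute:
  assumes "\<And>x. A (B x) = B (A x)"
  shows "(A ^^ m) ((B ^^ n) x) = (B ^^ n) ((A ^^ m) x)"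
proof -
  have 1: "A ((B ^^ n) x) = (B ^^ n) (A x)" for n x
    using assms by (induction n arbitrary: x) auto
  show ?thesis by (induction m arbitrary: x) (auto simp: 1)
qed

lemma pow_image_Suc: "(T ^^ Suc n) ` M = T ` (T ^^ n) ` M"
  by (simp add: image_comp)

lemma pow_image_antimono:
  assumes "T ` M \<subseteq> M" "m \<le> n" shows "(T ^^ n) ` M \<subseteq> (T ^^ m) ` M"
proof -
  have "(T ^^ n) ` M = (T ^^ m) ` ((T ^^ (n - m)) ` M)"
    using assms(2) by (simp add: image_comp flip: funpow_add)
  also have "\<dots> \<subseteq> (T ^^ m) ` M" using pow_invariant[OF assms(1)] by auto
  finally show ?thesis .
qed

lemma descent_stable:
  fixes T :: "'a \<Rightarrow> 'a"
  assumes "(T ^^ d) ` M = (T ^^ Suc d) ` M" "d \<le> n"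
  shows "(T ^^ n) ` M = (T ^^ d) ` M"
proof -
  have "(T ^^ (d + k)) ` M = (T ^^ d) ` M" for k
  proof (induction k)
    case (Suc k)
    have "(T ^^ (d + Suc k)) ` M = T ` (T ^^ (d + k)) ` M" unfolding add_Suc_right by (rule pow_image_Suc)
    also have "\<dots> = (T ^^ Suc d) ` M" unfolding Suc.IH by (rule pow_image_Suc[symmetric])
    finally show ?case using assms(1) by (rule trans[OF _ sym])
  qed simp
  from this[of "n - d"] show ?thesis using assms(2) by simp
qed

section \<open>Functionals\<close>

text \<open>A real extension g of the real part of f determines the complex functional g x - i g (i
  x). Estimating its modulus by real plus imaginary part costs the factor 2, which later only
  shrinks a radius of convergence.\<close>

lemma hahn_banach_complex:
  fixes f :: "'a::complex_normed_vector \<Rightarrow> complex"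
  assumes M: "cvec.subspace M"
    and add: "\<And>x y. x \<in> M \<Longrightarrow> y \<in> M \<Longrightarrow> f (x + y) = f x + f y"
    and sc: "\<And>c x. x \<in> M \<Longrightarrow> f (c *\<^sub>C x) = c * f x"
    and bd: "\<And>x. x \<in> M \<Longrightarrow> cmod (f x) \<le> C * norm x" and C: "C \<ge> 0"
  obtains \<phi> where "\<phi> \<in> dual_space" "\<And>x. x \<in> M \<Longrightarrow> blinfun_apply \<phi> x = f x" "norm \<phi> \<le> 2 * C"
proof -
  obtain g where g: "bounded_linear g" "\<And>x. x \<in> M \<Longrightarrow> g x = Re (f x)" "\<And>x. \<bar>g x\<bar> \<le> C * norm x"
  proof (rule hahn_banach_real[OF csubspace_imp_subspace[OF M], of "\<lambda>x. Re (f x)" C])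
    show "Re (f x) \<le> C * norm x" if "x \<in> M" for x
      using bd[OF that] complex_Re_le_cmod[of "f x"] by simp
  qed (simp_all add: add sc C scaleR_scaleC)
  interpret g: bounded_linear g by fact
  define F where "F = (\<lambda>x. Complex (g x) (- g (\<i> *\<^sub>C x)))"
  have Fsc: "F (c *\<^sub>C x) = c * F x" for c x
  proof -
    have c: "c = of_real (Re c) + of_real (Im c) * \<i>" by (simp add: complex_eq mult.commute)
    have 1: "c *\<^sub>C x = Re c *\<^sub>R x + Im c *\<^sub>R (\<i> *\<^sub>C x)"
      by (subst c) (simp add: scaleC_add_left scaleR_scaleC scaleC_scaleC)
    have 2: "\<i> *\<^sub>C (c *\<^sub>C x) = Re c *\<^sub>R (\<i> *\<^sub>C x) - Im c *\<^sub>R x"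
    proof -
      have "\<i> *\<^sub>C (c *\<^sub>C x) = (of_real (Re c) * \<i> - of_real (Im c)) *\<^sub>C x"
        by (simp add: complex_eq_iff)
      then show ?thesis by (simp add: cvec.scale_left_diff_distrib scaleR_scaleC scaleC_scaleC)
    qed
    have "g (c *\<^sub>C x) = Re c * g x + Im c * g (\<i> *\<^sub>C x)" by (simp only: 1 g.add g.scaleR real_scaleR_def)
    moreover have "g (\<i> *\<^sub>C (c *\<^sub>C x)) = Re c * g (\<i> *\<^sub>C x) - Im c * g x"
      by (simp only: 2 g.diff g.scaleR real_scaleR_def)
    ultimately show ?thesis unfolding F_def complex_eq_iff by (simp del: cvec.scale_scale)
  qed
  have Fn: "norm (F x) \<le> norm x * (2 * C)" for x
  proof -
    have "norm (F x) \<le> \<bar>g x\<bar> + \<bar>g (\<i> *\<^sub>C x)\<bar>"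
      using cmod_le[of "F x"] by (simp add: F_def)
    also have "\<dots> \<le> C * norm x + C * norm (\<i> *\<^sub>C x)" using g(3) add_mono by blast
    finally show ?thesis by (simp add: norm_scaleC algebra_simps)
  qed
  have "bounded_linear F"
  proof (rule bounded_linear_intro[of _ "2 * C"])
    show "F (x + y) = F x + F y" for x y by (simp add: F_def complex_eq_iff scaleC_add_right g.add)
    show "F (r *\<^sub>R x) = r *\<^sub>R F x" for r x by (simp add: scaleR_scaleC[of r x] Fsc scaleR_conv_of_real)
  qed (rule Fn)
  then have ap: "blinfun_apply (Blinfun F) = F" by (rule bounded_linear_Blinfun_apply)
  show thesis
  proof (rule that[of "Blinfun F"])
    show "Blinfun F \<in> dual_space" by (simp add: dual_space_def ap Fsc)
    show "norm (Blinfun F) \<le> 2 * C"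
      using Fn C by (intro norm_blinfun_bound) (simp_all add: ap mult.commute)
    fix x assume x: "x \<in> M"
    then have "\<i> *\<^sub>C x \<in> M" using M cvec.subspace_scale by blast
    then show "blinfun_apply (Blinfun F) x = f x"
      unfolding ap using x g(2) sc[of x \<i>] by (simp add: F_def complex_eq_iff)
  qed
qed

text \<open>A closed \<open>Y\<close> has positive distance from \<open>v\<close>, and scaling by
  \<open>c\<close> turns this distance into a bound for the coefficient of \<open>v\<close>.\<close>

lemma dist_closed_subspace_line:
  fixes v :: "'a::complex_normed_vector"
  assumes Y: "cvec.subspace Y" "closed Y" and v: "v \<notin> Y"
  obtains d where "d > 0" "\<And>y c. y \<in> Y \<Longrightarrow> d * cmod c \<le> norm (y + c *\<^sub>C v)"
proof -
  obtain d where d: "d > 0" "ball v d \<subseteq> - Y"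
    using Y(2) v open_contains_ball[of "- Y"] by auto
  show thesis
  proof (rule that[OF d(1)])
    fix y c assume y: "y \<in> Y"
    show "d * cmod c \<le> norm (y + c *\<^sub>C v)"
    proof (cases "c = 0")
      case False
      define w where "w = (- inverse c) *\<^sub>C y"
      have "w \<in> Y" unfolding w_def using y Y cvec.subspace_scale by blast
      then have "d \<le> norm (v - w)" using d by (force simp: dist_norm)
      then have "d * cmod c \<le> norm (c *\<^sub>C (v - w))" unfolding norm_scaleC using mult_left_mono[of d "norm (v - w)" "cmod c"] by (simp add: mult.commute)
      also have "c *\<^sub>C (v - w) = y + c *\<^sub>C v"
        using False by (simp add: w_def scaleC_add_right)
      finally show ?thesis .
    qed simp
  qed
qed

lemma separating_functional:
  fixes v :: "'a::complex_normed_vector"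
  assumes Y: "cvec.subspace Y" "closed Y" and v: "v \<notin> Y"
  obtains \<phi> where "\<phi> \<in> dual_space" "\<And>y. y \<in> Y \<Longrightarrow> blinfun_apply \<phi> y = 0" "blinfun_apply \<phi> v \<noteq> 0"
proof -
  obtain d where d: "d > 0" "\<And>y c. y \<in> Y \<Longrightarrow> d * cmod c \<le> norm (y + c *\<^sub>C v)"
    using dist_closed_subspace_line[OF assms] by blast
  \<comment> \<open>\<open>f z\<close> is the coefficient of \<open>v\<close> in \<open>z\<close>
    modulo \<open>Y\<close>. The distance bound makes it unique, hence linear, and bounded by 1/d on
    the span of \<open>Y\<close> and \<open>v\<close>.\<close>
  define f where "f = (\<lambda>z. SOME c. z - c *\<^sub>C v \<in> Y)"
  have uniq: "b = c" if "z - b *\<^sub>C v \<in> Y" "z - c *\<^sub>C v \<in> Y" for z b c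
  proof -
    have "(z - c *\<^sub>C v) - (z - b *\<^sub>C v) \<in> Y" using cvec.subspace_diff[OF Y(1) that(2,1)] .
    then have "d * cmod (c - b) \<le> norm ((z - c *\<^sub>C v) - (z - b *\<^sub>C v) + (c - b) *\<^sub>C v)" by (rule d(2))
    also have "\<dots> = 0" by (simp add: cvec.scale_left_diff_distrib)
    finally show ?thesis using d(1) by (simp add: mult_le_0_iff)
  qed
  have f: "f z = c" if "z - c *\<^sub>C v \<in> Y" for z c
    unfolding f_def by (rule uniq[OF someI[of "\<lambda>c. z - c *\<^sub>C v \<in> Y", OF that] that])
  define M where "M = cvec.span (insert v Y)"
  have M: "z \<in> M \<longleftrightarrow> (\<exists>c. z - c *\<^sub>C v \<in> Y)" for z
    unfolding M_def cvec.span_breakdown_eq cvec.span_eq_iff[THEN iffD2, OF Y(1)] ..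
  have fY: "z - f z *\<^sub>C v \<in> Y" if z: "z \<in> M" for z
  proof -
    obtain c where c: "z - c *\<^sub>C v \<in> Y" using M[THEN iffD1, OF z] by blast
    then show ?thesis by (simp only: f[OF c])
  qed
  obtain \<phi> where "\<phi> \<in> dual_space" "\<And>x. x \<in> M \<Longrightarrow> blinfun_apply \<phi> x = f x"
  proof (rule hahn_banach_complex[of M f "1 / d"])
    show "cvec.subspace M" unfolding M_def by simp
    show "f (x + y) = f x + f y" if "x \<in> M" "y \<in> M" for x y
    proof (rule f)
      have "(x - f x *\<^sub>C v) + (y - f y *\<^sub>C v) \<in> Y" by (intro cvec.subspace_add[OF Y(1)] fY that)
      then show "x + y - (f x + f y) *\<^sub>C v \<in> Y" by (simp add: scaleC_add_left algebra_simps)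
    qed
    show "f (c *\<^sub>C x) = c * f x" if "x \<in> M" for x c
    proof (rule f)
      have "c *\<^sub>C (x - f x *\<^sub>C v) \<in> Y" by (intro cvec.subspace_scale[OF Y(1)] fY that)
      then show "c *\<^sub>C x - (c * f x) *\<^sub>C v \<in> Y" by (simp add: cvec.scale_right_diff_distrib)
    qed
    show "cmod (f x) \<le> 1 / d * norm x" if "x \<in> M" for x
      using d(2)[OF fY[OF that], of "f x"] d(1) by (simp add: field_simps)
  qed (use d(1) in simp_all)
  moreover have "f y = 0" if "y \<in> Y" for y using that by (intro f) simp
  moreover have "f v = 1" using cvec.subspace_0[OF Y(1)] by (intro f) simp
  moreover have "y \<in> M" if "y \<in> insert v Y" for y unfolding M_def using that by (rule cvec.span_base)
  ultimately show thesis by (intro that[of \<phi>]) simp_all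
qed

section \<open>Finite codimension\<close>

text \<open>Along a convergent sequence in the sum, the distance bound makes the coefficients of
  \<open>a\<close> a Cauchy sequence; subtracting the limit coefficient leaves a limit of points of
  the closed set \<open>Y\<close>.\<close>

lemma closed_add_line:
  fixes a :: "'a::complex_normed_vector"
  assumes Y: "cvec.subspace Y" "closed Y"
  shows "closed (cvec.span (insert a Y))"
proof (cases "a \<in> Y")
  case True
  moreover have "cvec.span Y = Y" using Y(1) by (simp only: cvec.span_eq_iff)
  ultimately show ?thesis using Y(2) by (simp only: insert_absorb)
next
  case False
  then obtain d where d: "d > 0" "\<And>y c. y \<in> Y \<Longrightarrow> d * cmod c \<le> norm (y + c *\<^sub>C a)"
    using dist_closed_subspace_line[OF Y False] by blast
  have M: "z \<in> cvec.span (insert a Y) \<longleftrightarrow> (\<exists>c. z - c *\<^sub>C a \<in> Y)" for z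
    unfolding cvec.span_breakdown_eq cvec.span_eq_iff[THEN iffD2, OF Y(1)] ..
  show ?thesis
    unfolding closed_sequential_limits
  proof (intro allI impI)
    fix z l assume "(\<forall>n. z n \<in> cvec.span (insert a Y)) \<and> z \<longlonglongrightarrow> l"
    then have z: "\<forall>n. \<exists>c. z n - c *\<^sub>C a \<in> Y" and l: "z \<longlonglongrightarrow> l"
      unfolding M by blast+
    from choice[OF z] obtain c where c: "\<And>n. z n - c n *\<^sub>C a \<in> Y" by blast
    have "Cauchy c"
    proof (rule metric_CauchyI)
      fix e :: real assume e: "e > 0"
      then have "d * e > 0" using d by simp
      then obtain N where N: "\<And>m n. m \<ge> N \<Longrightarrow> n \<ge> N \<Longrightarrow> dist (z m) (z n) < d * e"
        using metric_CauchyD[OF LIMSEQ_imp_Cauchy[OF l]] by metis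
      show "\<exists>N. \<forall>m\<ge>N. \<forall>n\<ge>N. dist (c m) (c n) < e"
      proof (intro exI allI impI)
        fix m n assume mn: "m \<ge> N" "n \<ge> N"
        have "(z m - c m *\<^sub>C a) - (z n - c n *\<^sub>C a) \<in> Y" using cvec.subspace_diff[OF Y(1) c c] .
        then have "d * cmod (c m - c n) \<le> norm ((z m - c m *\<^sub>C a) - (z n - c n *\<^sub>C a) + (c m - c n) *\<^sub>C a)"
          by (rule d(2))
        also have "\<dots> = norm (z m - z n)" by (simp add: cvec.scale_left_diff_distrib)
        also have "\<dots> < d * e" using N[OF mn] by (simp add: dist_norm)
        finally show "dist (c m) (c n) < e" using d by (simp add: dist_norm)
      qed
    qed
    then obtain k where k: "c \<longlonglongrightarrow> k" using Cauchy_convergent convergent_def by blast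
    have "bounded_linear (\<lambda>t. t *\<^sub>C a)"
      by (rule bounded_linear_intro[of _ "norm a"])
        (simp_all add: scaleC_add_left scaleR_scaleC norm_scaleC scaleR_conv_of_real)
    from tendsto_diff[OF l bounded_linear.tendsto[OF this k]]
    have "(\<lambda>n. z n - c n *\<^sub>C a) \<longlonglongrightarrow> l - k *\<^sub>C a" .
    then have "l - k *\<^sub>C a \<in> Y" by (intro closed_sequentially[OF Y(2) c])
    then show "l \<in> cvec.span (insert a Y)" unfolding M ..
  qed
qed

lemma closed_add_span:
  fixes Y :: "'a::complex_normed_vector set"
  assumes "finite F" and Y: "cvec.subspace Y" "closed Y"
  shows "closed (cvec.span (Y \<union> F))"
  using assms(1)
proof induction
  case empty
  have "cvec.span Y = Y" using Y(1) by (simp only: cvec.span_eq_iff)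
  then show ?case using Y(2) by (simp only: Un_empty_right)
next
  case (insert a F)
  have "cvec.span (Y \<union> insert a F) = cvec.span (insert a (cvec.span (Y \<union> F)))"
    unfolding Un_insert_right cvec.span_insert[of a] cvec.span_span ..
  then show ?case using closed_add_line[OF cvec.subspace_span insert.IH] by simp
qed

lemma closed_finite_span: "finite F \<Longrightarrow> closed (cvec.span (F :: 'a::complex_normed_vector set))"
  using closed_add_span[of F "{0}", OF _ cvec.subspace_single_0] by simp

text \<open>Steinitz exchange modulo \<open>Y\<close>: as \<open>v\<close> is not in
  \<open>Y\<close>, some generator from \<open>F\<close> really enters its expansion and can be
  traded for \<open>v\<close>. This is how generating sets of least size are contradicted
  below.\<close>

lemma codim_exchange:
  assumes "finite F" "cvec.subspace Y" "v \<in> cvec.span (Y \<union> F)" "v \<notin> Y"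
  shows "\<exists>a\<in>F. a \<in> cvec.span (insert v (Y \<union> (F - {a})))"
  using assms(1,3)
proof (induction F)
  case empty
  then show ?case using assms(4) by (simp add: cvec.span_eq_iff[THEN iffD2, OF assms(2)])
next
  case (insert b F)
  show ?case
  proof (cases "v \<in> cvec.span (Y \<union> F)")
    case True
    then obtain a where a: "a \<in> F" "a \<in> cvec.span (insert v (Y \<union> (F - {a})))" using insert by blast
    then have "a \<in> cvec.span (insert v (Y \<union> (insert b F - {a})))"
      using cvec.span_mono[of "insert v (Y \<union> (F - {a}))" "insert v (Y \<union> (insert b F - {a}))"] by blast
    then show ?thesis using a by blast
  next
    case False
    then have "b \<in> cvec.span (insert v (Y \<union> F))"
      using insert.prems cvec.in_span_insert[of v b "Y \<union> F"] by simp
    then show ?thesis using insert.hyps by (intro bexI[of _ b]) auto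
  qed
qed

text \<open>A generating set modulo \<open>R\<close> of least size is automatically independent of
  \<open>R\<close>: a non-zero vector of \<open>R\<close> in the span of \<open>F\<close> could be
  exchanged for a generator, which would then be redundant.\<close>

lemma finite_complement:
  assumes R: "cvec.subspace R" and fin: "fin_codim_in M R"
  obtains F where "finite F" "F \<subseteq> M" "M \<subseteq> cvec.span (R \<union> F)" "R \<inter> cvec.span F = {0}"
proof -
  define P where "P = (\<lambda>F. finite F \<and> F \<subseteq> M \<and> M \<subseteq> cvec.span (R \<union> F))"
  obtain F where F: "P F" and min: "\<And>G. P G \<Longrightarrow> card F \<le> card G"
    using fin fin_codim_in_iff[OF R] ex_has_least_nat[of P _ card] unfolding P_def by metis
  have "v = 0" if v: "v \<in> R" "v \<in> cvec.span F" for v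
  proof (rule ccontr)
    assume "v \<noteq> 0"
    then obtain a where a: "a \<in> F" "a \<in> cvec.span (insert v ({0} \<union> (F - {a})))"
      using codim_exchange[of F "{0}" v] F v by (auto simp: P_def cvec.subspace_single_0)
    have "cvec.span (insert v ({0} \<union> (F - {a}))) \<subseteq> cvec.span (R \<union> (F - {a}))"
      using v R cvec.subspace_0 by (intro cvec.span_mono) auto
    then have "F \<subseteq> cvec.span (R \<union> (F - {a}))" using a by (auto intro: cvec.span_base)
    then have "R \<union> F \<subseteq> cvec.span (R \<union> (F - {a}))" by (auto intro: cvec.span_base)
    then have "cvec.span (R \<union> F) \<subseteq> cvec.span (R \<union> (F - {a}))" by (simp add: cvec.span_minimal)
    then have "P (F - {a})" using F by (auto simp: P_def)
    from min[OF this] show False using card_Diff1_less[of F a] a F by (simp add: P_def)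
  qed
  moreover have "0 \<in> R" using R cvec.subspace_0 by blast
  ultimately show thesis using that[of F] F cvec.span_zero unfolding P_def by blast
qed

text \<open>This is the open mapping theorem for the map (x, v) \<mapsto> f x + v on the product of
  \<open>S\<close> and \<open>V\<close>.\<close>

lemma sum_decomposition_bound:
  fixes f :: "'a::banach \<Rightarrow> 'b::banach"
  assumes f: "bounded_linear f" and S: "subspace S" "closed S" and V: "subspace V" "closed V"
    and R: "closed {f x + v | x v. x \<in> S \<and> v \<in> V}"
  obtains C where "C > 0"
    "\<And>x v. x \<in> S \<Longrightarrow> v \<in> V \<Longrightarrow> \<exists>x'\<in>S. \<exists>v'\<in>V. f x' + v' = f x + v \<and> norm x' \<le> C * norm (f x + v) \<and> norm v' \<le> C * norm (f x + v)"
proof -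
  define g where "g = (\<lambda>p. f (fst p) + snd p)"
  have g: "bounded_linear g" unfolding g_def
    by (intro bounded_linear_add bounded_linear_compose[OF f] bounded_linear_fst bounded_linear_snd)
  have im: "g ` (S \<times> V) = {f x + v | x v. x \<in> S \<and> v \<in> V}" by (force simp: g_def)
  obtain C where C: "C > 0" "\<And>y. y \<in> g ` (S \<times> V) \<Longrightarrow> \<exists>x\<in>S \<times> V. g x = y \<and> norm x \<le> C * norm y"
    using open_mapping_subspace[OF g subspace_Times[OF S(1) V(1)] closed_Times[OF S(2) V(2)], unfolded im, OF R]
    unfolding im by blast
  show thesis
  proof (rule that[OF C(1)])
    fix x v assume "x \<in> S" "v \<in> V"
    then have "f x + v \<in> g ` (S \<times> V)" unfolding im by blast
    then obtain p where p: "p \<in> S \<times> V" "g p = f x + v" "norm p \<le> C * norm (f x + v)" using C(2) by blast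
    then show "\<exists>x'\<in>S. \<exists>v'\<in>V. f x' + v' = f x + v \<and> norm x' \<le> C * norm (f x + v) \<and> norm v' \<le> C * norm (f x + v)"
      using norm_fst_le[of "fst p" "snd p"] norm_snd_le[of "snd p" "fst p"] unfolding g_def by force
  qed
qed

text \<open>With a finite-dimensional complement \<open>V\<close> the sum is all of the closed set
  \<open>M\<close>, so the pieces of a sum are controlled by its norm, and directness makes the
  piece in \<open>V\<close> unique. If points z n of the range converge to T x0 + v0, the piece of
  the limit minus z n in \<open>V\<close> is always v0; hence |v0| is bounded by a null sequence and
  v0 = 0.\<close>

lemma closed_finite_codim_range:
  fixes T :: "'a::{complex_normed_vector, banach} \<Rightarrow> 'a"
  assumes T: "bop T" and S: "cvec.subspace S" "closed S" and M: "cvec.subspace M" "closed M"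
    and TS: "T ` S \<subseteq> M" and fin: "fin_codim_in M (T ` S)"
  shows "closed (T ` S)"
proof -
  have R: "cvec.subspace (T ` S)" using bop_subspace_image T S by blast
  obtain F where F: "finite F" "F \<subseteq> M" "M \<subseteq> cvec.span (T ` S \<union> F)" "T ` S \<inter> cvec.span F = {0}"
    using finite_complement[OF R fin] .
  define V where "V = cvec.span F"
  have V: "cvec.subspace V" "closed V" unfolding V_def using closed_finite_span[OF F(1)] by auto
  have "{T x + v | x v. x \<in> S \<and> v \<in> V} = {r + y | r y. r \<in> T ` S \<and> y \<in> V}" by auto
  also have "\<dots> = cvec.span (T ` S \<union> F)"
    unfolding V_def cvec.span_Un cvec.span_eq_iff[THEN iffD2, OF R] ..
  also have "\<dots> = M" using F TS M cvec.span_minimal[of "T ` S \<union> F" M] by blast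
  finally have sumM: "{T x + v | x v. x \<in> S \<and> v \<in> V} = M" .
  have cl: "closed {T x + v | x v. x \<in> S \<and> v \<in> V}" unfolding sumM by (rule M(2))
  obtain C where C: "C > 0" "\<And>x v. x \<in> S \<Longrightarrow> v \<in> V \<Longrightarrow>
      \<exists>x'\<in>S. \<exists>v'\<in>V. T x' + v' = T x + v \<and> norm x' \<le> C * norm (T x + v) \<and> norm v' \<le> C * norm (T x + v)"
    by (rule sum_decomposition_bound[OF bop_bl[OF T] csubspace_imp_subspace[OF S(1)] S(2)
          csubspace_imp_subspace[OF V(1)] V(2) cl]) (rule that)
  have dir: "v = w" if "T x + v = T y + w" "x \<in> S" "y \<in> S" "v \<in> V" "w \<in> V" for x y v w
  proof -
    have "T (x - y) = w - v" using that(1) by (simp add: bop_diff[OF T] algebra_simps)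
    moreover have "x - y \<in> S" "w - v \<in> V" using that S V cvec.subspace_diff by blast+
    ultimately have "w - v \<in> T ` S \<inter> cvec.span F" unfolding V_def by (metis IntI imageI)
    then have "w - v = 0" unfolding F(4) by simp
    then show ?thesis by simp
  qed
  show ?thesis
    unfolding closed_sequential_limits
  proof (intro allI impI)
    fix z l assume z: "(\<forall>n. z n \<in> T ` S) \<and> z \<longlonglongrightarrow> l"
    then have "l \<in> M" using closed_sequentially[OF M(2), of z l] TS by blast
    then obtain x0 v0 where l: "l = T x0 + v0" "x0 \<in> S" "v0 \<in> V" using sumM by blast
    have "norm v0 \<le> C * norm (l - z n)" for n
    proof -
      obtain x where x: "x \<in> S" "z n = T x" using z by blast
      have e: "l - z n = T (x0 - x) + v0" using l x by (simp add: bop_diff[OF T])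
      have xS: "x0 - x \<in> S" using l x S cvec.subspace_diff by blast
      obtain x' v' where "x' \<in> S" "v' \<in> V" "T x' + v' = T (x0 - x) + v0" "norm v' \<le> C * norm (l - z n)"
        using C(2)[OF xS l(3)] e by auto
      then show ?thesis using dir[of x' v' "x0 - x" v0] xS l by auto
    qed
    moreover have "(\<lambda>n. C * norm (l - z n)) \<longlonglongrightarrow> C * norm (l - l)"
      using z by (intro tendsto_intros) auto
    ultimately have "norm v0 \<le> 0" using LIMSEQ_le_const by fastforce
    then show "l \<in> T ` S" using l by auto
  qed
qed

text \<open>If G generates M modulo T^n M, then T G generates T M modulo T^(n+1) M; adding the
  generators of M modulo T M gives all of M.\<close>

lemma fin_codim_pow:
  assumes T: "bop T" and M: "cvec.subspace M" "T ` M \<subseteq> M" and fin: "fin_codim_in M (T ` M)"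
  shows "fin_codim_in M ((T ^^ n) ` M)"
proof (induction n)
  case 0
  then show ?case unfolding fin_codim_in_def using cvec.span_zero
    by (intro exI[of _ "{}"]) (auto simp: cspan_eq)
next
  case (Suc n)
  have R: "cvec.subspace ((T ^^ n) ` M)" for n using bop_pow[OF T] M bop_subspace_image by blast
  have R1: "cvec.subspace (T ` M)" using T M bop_subspace_image by blast
  obtain F where F: "finite F" "F \<subseteq> M" "M \<subseteq> cvec.span (T ` M \<union> F)"
    using fin_codim_in_iff[OF R1, THEN iffD1, OF fin] by blast
  obtain G where G: "finite G" "G \<subseteq> M" "M \<subseteq> cvec.span ((T ^^ n) ` M \<union> G)"
    using fin_codim_in_iff[OF R, THEN iffD1, OF Suc.IH] by blast
  have "T ` M \<subseteq> T ` cvec.span ((T ^^ n) ` M \<union> G)" using G by blast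
  also have "\<dots> = cvec.span ((T ^^ Suc n) ` M \<union> T ` G)"
    by (simp only: bop_span_image[OF T] image_Un pow_image_Suc)
  finally have "T ` M \<union> F \<subseteq> cvec.span ((T ^^ Suc n) ` M \<union> (T ` G \<union> F))"
    using cvec.span_mono[of "(T ^^ Suc n) ` M \<union> T ` G" "(T ^^ Suc n) ` M \<union> (T ` G \<union> F)"]
    by (auto intro: cvec.span_base)
  then have "M \<subseteq> cvec.span ((T ^^ Suc n) ` M \<union> (T ` G \<union> F))"
    using F(3) cvec.span_minimal[OF _ cvec.subspace_span] by blast
  then show ?case unfolding fin_codim_in_iff[OF R]
  proof (intro exI conjI)
    show "finite (T ` G \<union> F)" using F G by simp
    show "T ` G \<union> F \<subseteq> M" using F G M by blast
  qed
qed

text \<open>The index p minimises the dimension. A vector of \<open>K p\<close> outside a later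
  \<open>K n\<close> would extend a basis of \<open>K n\<close> to an independent set in
  \<open>K p\<close> that is larger than the dimension of \<open>K p\<close>.\<close>

lemma decreasing_subspaces_stable:
  fixes K :: "nat \<Rightarrow> 'a::complex_vector set"
  assumes K: "\<And>n. cvec.subspace (K n)" and dec: "\<And>m n. m \<le> n \<Longrightarrow> K n \<subseteq> K m"
    and F: "finite F" "K 0 \<subseteq> cvec.span F"
  shows "\<exists>p. \<forall>n\<ge>p. K n = K p"
proof -
  obtain p where p: "\<And>n. cvec.dim (K p) \<le> cvec.dim (K n)"
    using ex_has_least_nat[of "\<lambda>_. True" 0 "\<lambda>n. cvec.dim (K n)"] by auto
  have "K p \<subseteq> K n" if "n \<ge> p" for n
  proof -
    obtain B where B: "B \<subseteq> K n" "cvec.independent B" "K n \<subseteq> cvec.span B" "card B = cvec.dim (K n)"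
      using cvec.basis_exists by blast
    obtain C where C: "C \<subseteq> K p" "cvec.independent C" "K p \<subseteq> cvec.span C" "card C = cvec.dim (K p)"
      using cvec.basis_exists by blast
    have "C \<subseteq> cvec.span F" using order_trans[OF C(1) order_trans[OF dec[OF le0] F(2)]] .
    moreover have "B \<subseteq> cvec.span F" using order_trans[OF B(1) order_trans[OF dec[OF le0] F(2)]] .
    ultimately have fC: "finite C" and fB: "finite B"
      using cvec.independent_span_bound[OF F(1) C(2)] cvec.independent_span_bound[OF F(1) B(2)] by simp_all
    have "K p \<subseteq> cvec.span B"
    proof
      fix x assume x: "x \<in> K p"
      show "x \<in> cvec.span B"
      proof (rule ccontr)
        assume nx: "x \<notin> cvec.span B"
        then have "cvec.independent (insert x B)" using cvec.independent_insertI[OF _ B(2)] by simp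
        moreover have "insert x B \<subseteq> cvec.span C" using x B C dec[OF that] by blast
        ultimately have "card (insert x B) \<le> card C" using cvec.independent_span_bound[OF fC] by simp
        moreover have "x \<notin> B" using nx cvec.span_base by blast
        ultimately show False using p[of n] B C fB by simp
      qed
    qed
    also have "\<dots> \<subseteq> K n" using B K cvec.span_minimal by blast
    finally show ?thesis .
  qed
  then show ?thesis using dec by blast
qed

text \<open>\<open>fin_cdim\<close> demands generators inside the set itself, so \<open>F\<close> is
  replaced by a maximal independent subset of \<open>K\<close>.\<close>

lemma fin_cdim_subset:
  assumes "finite F" "K \<subseteq> cvec.span F"
  shows "fin_cdim K"
proof -
  obtain B where B: "B \<subseteq> K" "cvec.independent B" "K \<subseteq> cvec.span B"
    by (rule cvec.basis_exists[of K])
  have "finite B" using cvec.independent_span_bound[OF assms(1) B(2) order_trans[OF B(1) assms(2)]] ..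
  then show ?thesis unfolding fin_cdim_iff using B(1,3) by (intro exI[of _ B]) simp
qed

section \<open>Surjectivity under small shifts\<close>

lemma surj_perturbation:
  fixes T :: "'a::{complex_normed_vector, banach} \<Rightarrow> 'a"
  assumes T: "bop T" and M: "cvec.subspace M" "closed M" and surj: "T ` M = M"
  obtains e where "e > 0" "\<And>l. cmod l < e \<Longrightarrow> shift T l ` M = M"
proof -
  obtain C where C: "C > 0" "\<And>y. y \<in> M \<Longrightarrow> \<exists>x\<in>M. T x = y \<and> norm x \<le> C * norm y"
    by (rule open_mapping_subspace[OF bop_bl[OF T] csubspace_imp_subspace[OF M(1)] M(2), unfolded surj, OF M(2)])
      (rule that)
  \<comment> \<open>A solution of T x = y with |x| \<le> C |y| solves the shifted equation up to l
    x, and |l| < 1 / (2C) makes this error at most |y|/2.\<close>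
  show thesis
  proof (rule that[of "1 / (2 * C)"])
    show "1 / (2 * C) > 0" using C by simp
    fix l assume l: "cmod l < 1 / (2 * C)"
    then have lC: "cmod l * C \<le> 1/2" using C by (simp add: field_simps)
    have step: "\<exists>x\<in>M. norm x \<le> C * norm y \<and> y - shift T l x \<in> M \<and> norm (y - shift T l x) \<le> 1/2 * norm y"
      if y: "y \<in> M" for y
    proof -
      obtain x where x: "x \<in> M" "T x = y" "norm x \<le> C * norm y" using C y by blast
      have e: "y - shift T l x = l *\<^sub>C x" using x by (simp add: shift_def)
      have "norm (l *\<^sub>C x) \<le> cmod l * (C * norm y)" using x by (simp add: norm_scaleC mult_left_mono)
      also have "\<dots> \<le> 1/2 * norm y" using lC mult_right_mono[OF lC, of "norm y"] by (simp add: mult_ac)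
      finally show ?thesis unfolding e[symmetric] using x cvec.subspace_scale[OF M(1) x(1), of l] unfolding e[symmetric] by blast
    qed
    have "M \<subseteq> shift T l ` M"
    proof
      fix y assume "y \<in> M"
      then obtain x where "x \<in> M" "shift T l x = y"
        using approx_surj_imp_surj[OF bop_bl[OF bop_shift[OF T, of l]] csubspace_imp_subspace[OF M(1)] M(2) _ _ _ step] C
        by force
      then show "y \<in> shift T l ` M" by blast
    qed
    moreover have "shift T l ` M \<subseteq> M" using shift_invariant M surj by blast
    ultimately show "shift T l ` M = M" by blast
  qed
qed

section \<open>Analytic families of functionals\<close>

lemma dscale_apply: "blinfun_apply (dscale c \<phi>) x = blinfun_apply \<phi> x * c"
  by (simp add: dscale_def)

lemma norm_dscale_le: "norm (dscale c \<phi>) \<le> norm \<phi> * cmod c"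
proof (rule norm_blinfun_bound)
  show "norm (blinfun_apply (dscale c \<phi>) x) \<le> norm \<phi> * cmod c * norm x" for x
    using mult_right_mono[OF norm_blinfun[of \<phi> x] norm_ge_zero[of c]]
    by (simp add: dscale_apply norm_mult mult_ac)
qed simp

lemma dscale_bilinear: "bounded_bilinear dscale"
proof
  show "\<exists>K. \<forall>a b. norm (dscale a b) \<le> norm a * norm b * K"
    using norm_dscale_le by (intro exI[of _ 1]) (auto simp: mult.commute)
qed (auto intro!: blinfun_eqI simp: dscale_apply blinfun.bilinear_simps algebra_simps)

lemma dual_space_scaleC: "\<phi> \<in> dual_space \<Longrightarrow> blinfun_apply \<phi> (c *\<^sub>C x) = c * blinfun_apply \<phi> x"
  by (simp add: dual_space_def)

text \<open>The family is the sum of l^n \<phi> n. The bound suggests the radius 1/K; half of it is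
  taken so that the ratio is at most 1/2 and the termwise derivatives are majorised by a multiple of
  n (1/2)^(n-1), which allows differentiation under the sum in the dual norm.\<close>

lemma dual_power_series:
  fixes \<phi> :: "nat \<Rightarrow> 'a::{complex_normed_vector} \<Rightarrow>\<^sub>L complex"
  assumes dual: "\<And>n. \<phi> n \<in> dual_space" and bd: "\<And>n. norm (\<phi> n) \<le> B * K ^ n" and K: "K > 0"
  obtains f where "dual_analytic_on (ball 0 (1 / (2 * K))) f"
    "\<And>l x. l \<in> ball 0 (1 / (2 * K)) \<Longrightarrow> (\<lambda>n. blinfun_apply (\<phi> n) x * l ^ n) sums blinfun_apply (f l) x"
proof -
  interpret ds: bounded_bilinear "dscale :: complex \<Rightarrow> ('a \<Rightarrow>\<^sub>L complex) \<Rightarrow> _" by (rule dscale_bilinear)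
  define S where "S = ball (0::complex) (1 / (2 * K))"
  define c where "c = (\<lambda>n l. of_nat n * l ^ (n - 1) :: complex)"
  define G where "G = (\<lambda>l. \<Sum>n. dscale (c n l) (\<phi> n))"
  have Kl: "K * cmod l \<le> 1 / 2" if "l \<in> S" for l
    using that K by (simp add: S_def field_simps)
  have B: "B \<ge> 0" using bd[of 0] norm_ge_zero[of "\<phi> 0"] by (simp del: norm_ge_zero)
  have der: "((\<lambda>l. dscale (l ^ n) (\<phi> n)) has_derivative (\<lambda>h. dscale h (dscale (c n l) (\<phi> n)))) (at l within S)" for n l
  proof -
    have "((\<lambda>l. l ^ n) has_derivative (\<lambda>h. c n l * h)) (at l within S)"
      unfolding c_def by (auto intro!: derivative_eq_intros simp: mult_ac)
    from bounded_linear.has_derivative[OF ds.bounded_linear_left this]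
    have "((\<lambda>l. dscale (l ^ n) (\<phi> n)) has_derivative (\<lambda>h. dscale (c n l * h) (\<phi> n))) (at l within S)" .
    moreover have "dscale (c n l * h) (\<phi> n) = dscale h (dscale (c n l) (\<phi> n))" for h
      by (intro blinfun_eqI) (simp add: dscale_apply)
    ultimately show ?thesis by simp
  qed
  have unif: "uniform_limit S (\<lambda>n l. \<Sum>i<n. dscale (c i l) (\<phi> i)) G sequentially"
    unfolding G_def
  proof (rule Weierstrass_m_test)
    show "norm (dscale (c n l) (\<phi> n)) \<le> B * K * (real n * (1/2) ^ (n - 1))" if l: "l \<in> S" for n l
    proof (cases n)
      case (Suc m)
      have "norm (dscale (c n l) (\<phi> n)) \<le> norm (\<phi> n) * cmod (c n l)" by (rule norm_dscale_le)
      also have "\<dots> \<le> (B * K ^ n) * (real n * cmod l ^ m)"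
        using bd[of n] by (intro mult_mono) (auto simp: c_def Suc norm_mult norm_power B K less_imp_le simp del: of_nat_Suc)
      also have "\<dots> = B * K * (real n * (K * cmod l) ^ m)" by (simp add: Suc power_mult_distrib)
      also have "\<dots> \<le> B * K * (real n * (1/2) ^ m)"
        using B K Kl[OF l] by (intro mult_left_mono power_mono) auto
      finally show ?thesis by (simp add: Suc)
    qed (simp add: c_def ds.zero_left)
    have "(\<lambda>n. of_nat (Suc n) * (1/2) ^ n) sums (1 / (1 - 1/2 :: real)\<^sup>2)"
      by (rule geometric_deriv_sums) simp
    then have "summable (\<lambda>n. real (Suc n) * (1/2) ^ (Suc n - 1))" by (simp add: sums_iff)
    then have "summable (\<lambda>n. real n * (1/2) ^ (n - 1))" by (rule summable_Suc_iff[THEN iffD1])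
    then show "summable (\<lambda>n. B * K * (real n * (1/2) ^ (n - 1)))" by (rule summable_mult)
  qed
  have ev: "\<forall>\<^sub>F n in sequentially. \<forall>l\<in>S. \<forall>h. norm ((\<Sum>i<n. dscale h (dscale (c i l) (\<phi> i))) - dscale h (G l)) \<le> e * norm h"
    if e: "e > 0" for e
    using unif[unfolded uniform_limit_iff, rule_format, OF e]
  proof (rule eventually_mono, intro ballI allI)
    fix n l h assume *: "\<forall>l\<in>S. dist (\<Sum>i<n. dscale (c i l) (\<phi> i)) (G l) < e" and l: "l \<in> S"
    have "(\<Sum>i<n. dscale h (dscale (c i l) (\<phi> i))) - dscale h (G l) = dscale h ((\<Sum>i<n. dscale (c i l) (\<phi> i)) - G l)"
      by (simp add: ds.diff_right ds.sum_right)
    also have "norm \<dots> \<le> norm ((\<Sum>i<n. dscale (c i l) (\<phi> i)) - G l) * norm h" by (rule norm_dscale_le)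
    also have "\<dots> \<le> e * norm h" using * l by (intro mult_right_mono) (auto simp: dist_norm less_imp_le)
    finally show "norm ((\<Sum>i<n. dscale h (dscale (c i l) (\<phi> i))) - dscale h (G l)) \<le> e * norm h" .
  qed
  have S0: "0 \<in> S" "convex S" "open S" using K by (auto simp: S_def)
  \<comment> \<open>Differentiating the series termwise requires convergence at one point. At 0 only
    the term n = 0 survives, since 0 ^ 0 = 1.\<close>
  have "(\<lambda>n. dscale (0 ^ n) (\<phi> n)) sums (\<Sum>n\<in>{0}. dscale (0 ^ n) (\<phi> n))"
    by (intro sums_finite) (auto simp: ds.zero_left power_0_left)
  from has_derivative_series[OF S0(2) der ev S0(1) this]
  obtain f where f: "\<And>l. l \<in> S \<Longrightarrow> (\<lambda>n. dscale (l ^ n) (\<phi> n)) sums f l"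
      "\<And>l. l \<in> S \<Longrightarrow> (f has_derivative (\<lambda>h. dscale h (G l))) (at l within S)" by blast
  have ev: "(\<lambda>n. blinfun_apply (\<phi> n) x * l ^ n) sums blinfun_apply (f l) x" if "l \<in> S" for l x
  proof -
    have "bounded_linear (\<lambda>\<psi>. blinfun_apply \<psi> x)" by (rule blinfun.bounded_linear_left)
    from bounded_linear.sums[OF this f(1)[OF that]] show ?thesis by (simp add: dscale_apply)
  qed
  show thesis
  proof (rule that[of f])
    show "dual_analytic_on (ball 0 (1 / (2 * K))) f"
      unfolding dual_analytic_on_def S_def[symmetric]
    proof (intro conjI ballI)
      fix l assume l: "l \<in> S"
      show "\<exists>g. (f has_derivative (\<lambda>h. dscale h g)) (at l)"
        using f(2)[OF l] at_within_open[OF l S0(3)] by auto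
      show "f l \<in> dual_space"
        unfolding dual_space_def mem_Collect_eq
      proof (intro allI)
        fix a x
        have "(\<lambda>n. blinfun_apply (\<phi> n) (a *\<^sub>C x) * l ^ n) sums (a * blinfun_apply (f l) x)"
          using sums_mult[OF ev[OF l, of x], of a] by (simp add: dual_space_scaleC[OF dual] mult.assoc)
        then show "blinfun_apply (f l) (a *\<^sub>C x) = a * blinfun_apply (f l) x"
          using ev[OF l] sums_unique2 by blast
      qed
    qed
  qed (use ev S_def in auto)
qed

text \<open>A functional that vanishes on the kernel factors through T: its value at any preimage of
  y defines \<psi> y on T M. Preimages chosen with |x| \<le> C |y| give boundedness although the
  choice itself is not linear; Hahn-Banach then extends \<psi> to the whole space at the cost of a
  factor 2.\<close>

lemma kato_functional_lift:
  fixes T :: "'a::complex_normed_vector \<Rightarrow> 'a"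
  assumes T: "bop T" and M: "cvec.subspace M" and C: "C > 0"
    and lift: "\<And>y. y \<in> T ` M \<Longrightarrow> \<exists>x\<in>M. T x = y \<and> norm x \<le> C * norm y"
    and \<phi>: "\<phi> \<in> dual_space" "\<And>x. x \<in> kerM T M \<Longrightarrow> blinfun_apply \<phi> x = 0"
  shows "\<exists>\<psi>\<in>dual_space. (\<forall>x\<in>M. blinfun_apply \<psi> (T x) = blinfun_apply \<phi> x) \<and> norm \<psi> \<le> 2 * (norm \<phi> * C)"
proof -
  define s where "s = (\<lambda>y. SOME x. x \<in> M \<and> T x = y \<and> norm x \<le> C * norm y)"
  have s: "s y \<in> M" "T (s y) = y" "norm (s y) \<le> C * norm y" if "y \<in> T ` M" for y
    unfolding s_def using someI_ex[of "\<lambda>x. x \<in> M \<and> T x = y \<and> norm x \<le> C * norm y"] lift[OF that] by blast+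
  define f where "f = (\<lambda>y. blinfun_apply \<phi> (s y))"
  have f: "f y = blinfun_apply \<phi> x" if x: "x \<in> M" and y: "y = T x" for x y
  proof -
    have yT: "y \<in> T ` M" using x y by blast
    have "s y - x \<in> M" using cvec.subspace_diff[OF M s(1)[OF yT] x] .
    moreover have "T (s y - x) = 0" using s(2)[OF yT] y by (simp add: bop_diff[OF T])
    ultimately have "blinfun_apply \<phi> (s y - x) = 0" by (intro \<phi>(2)) (simp add: kerM_def)
    then show ?thesis by (simp add: f_def blinfun.diff_right)
  qed
  obtain \<psi> where "\<psi> \<in> dual_space" "\<And>y. y \<in> T ` M \<Longrightarrow> blinfun_apply \<psi> y = f y" "norm \<psi> \<le> 2 * (norm \<phi> * C)"
  proof (rule hahn_banach_complex[of "T ` M" f "norm \<phi> * C"])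
    show "cvec.subspace (T ` M)" by (rule bop_subspace_image[OF T M])
    show "f (x + y) = f x + f y" if xy: "x \<in> T ` M" "y \<in> T ` M" for x y
    proof -
      have "f (x + y) = blinfun_apply \<phi> (s x + s y)"
        using s[OF xy(1)] s[OF xy(2)] by (intro f cvec.subspace_add[OF M]) (simp_all add: bop_add[OF T])
      then show ?thesis by (simp add: f_def blinfun.add_right)
    qed
    show "f (c *\<^sub>C x) = c * f x" if x: "x \<in> T ` M" for c x
    proof -
      have "f (c *\<^sub>C x) = blinfun_apply \<phi> (c *\<^sub>C s x)"
        using s[OF x] by (intro f cvec.subspace_scale[OF M]) (simp_all add: bop_scaleC[OF T])
      then show ?thesis by (simp add: f_def dual_space_scaleC[OF \<phi>(1)])
    qed
    show "cmod (f y) \<le> norm \<phi> * C * norm y" if y: "y \<in> T ` M" for y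
    proof -
      have "cmod (f y) \<le> norm \<phi> * norm (s y)" unfolding f_def by (rule norm_blinfun)
      also have "\<dots> \<le> norm \<phi> * (C * norm y)" using s(3)[OF y] by (intro mult_left_mono) auto
      finally show ?thesis by (simp add: mult.assoc)
    qed
  qed (use C in auto)
  then show ?thesis using f by (intro bexI[of _ \<psi>]) auto
qed

lemma kato_not_surj_functionals:
  fixes T :: "'a::{complex_normed_vector, banach} \<Rightarrow> 'a"
  assumes T: "bop T" and M: "cvec.subspace M" "closed M" "T ` M \<subseteq> M"
    and kato: "kato_on M T" and ns: "T ` M \<noteq> M"
  obtains r f v where "r > 0" "dual_analytic_on (ball 0 r) f"
    "\<And>l x. l \<in> ball 0 r \<Longrightarrow> x \<in> M \<Longrightarrow> blinfun_apply (f l) (shift T l x) = 0"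
    "v \<in> M" "blinfun_apply (f 0) v \<noteq> 0"
proof -
  have cl: "closed (T ` M)" and ker: "\<And>n. kerM T M \<subseteq> (T ^^ n) ` M"
    using kato unfolding kato_on_def by blast+
  obtain v where v: "v \<in> M" "v \<notin> T ` M" using M ns by blast
  obtain \<phi>0 where \<phi>0: "\<phi>0 \<in> dual_space" "\<And>y. y \<in> T ` M \<Longrightarrow> blinfun_apply \<phi>0 y = 0" "blinfun_apply \<phi>0 v \<noteq> 0"
    by (rule separating_functional[OF bop_subspace_image[OF T M(1)] cl v(2)]) (rule that)
  obtain C where C: "C > 0" "\<And>y. y \<in> T ` M \<Longrightarrow> \<exists>x\<in>M. T x = y \<and> norm x \<le> C * norm y"
    by (rule open_mapping_subspace[OF bop_bl[OF T] csubspace_imp_subspace[OF M(1)] M(2) cl]) (rule that)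
  \<comment> \<open>The growth by 2C per step is the constant of
    \<open>kato_functional_lift\<close>. The last clause, that \<phi> after T^n is \<phi>0 on M, is
    the invariant that permits the next lift.\<close>
  define P where "P = (\<lambda>n \<phi>. \<phi> \<in> dual_space \<and> norm \<phi> \<le> norm \<phi>0 * (2 * C) ^ n \<and> (n = 0 \<longrightarrow> \<phi> = \<phi>0) \<and>
      (\<forall>x\<in>M. blinfun_apply \<phi> ((T ^^ n) x) = blinfun_apply \<phi>0 x))"
  have "\<exists>\<phi>. \<forall>n. P n (\<phi> n) \<and> (\<forall>x\<in>M. blinfun_apply (\<phi> (Suc n)) (T x) = blinfun_apply (\<phi> n) x)"
  proof (rule dependent_nat_choice)
    show "\<exists>\<phi>. P 0 \<phi>" using \<phi>0(1) by (intro exI[of _ \<phi>0]) (simp add: P_def)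
    fix \<phi> n assume P: "P n \<phi>"
    \<comment> \<open>By the Kato property a kernel vector is T^(n+1) w with w in M; the invariant
      turns its value into \<phi>0 (T w) = 0.\<close>
    have "blinfun_apply \<phi> x = 0" if x: "x \<in> kerM T M" for x
    proof -
      have "x \<in> (T ^^ Suc n) ` M" using x ker by blast
      then obtain w where w: "w \<in> M" "x = (T ^^ n) (T w)" by (auto simp: funpow_Suc_right simp del: funpow.simps)
      have "T w \<in> M" using w M(3) by blast
      then have "blinfun_apply \<phi> x = blinfun_apply \<phi>0 (T w)" using P w(2) by (simp add: P_def)
      then show ?thesis using \<phi>0(2) w(1) by simp
    qed
    from kato_functional_lift[OF T M(1) C _ this]
    obtain \<psi> where \<psi>: "\<psi> \<in> dual_space" "\<forall>x\<in>M. blinfun_apply \<psi> (T x) = blinfun_apply \<phi> x"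
        "norm \<psi> \<le> 2 * (norm \<phi> * C)"
      using P unfolding P_def by blast
    have "norm \<psi> \<le> norm \<phi> * (2 * C)" using \<psi>(3) by simp
    also have "\<dots> \<le> (norm \<phi>0 * (2 * C) ^ n) * (2 * C)"
      using P C(1) by (intro mult_right_mono) (auto simp: P_def)
    finally have "norm \<psi> \<le> norm \<phi>0 * (2 * C) ^ Suc n" by (simp add: mult_ac)
    moreover have "blinfun_apply \<psi> ((T ^^ Suc n) x) = blinfun_apply \<phi>0 x" if "x \<in> M" for x
      using \<psi>(2) pow_invariant[OF M(3) that, of n] P that by (simp add: P_def)
    ultimately have "P (Suc n) \<psi>" using \<psi>(1) unfolding P_def by blast
    then show "\<exists>\<psi>. P (Suc n) \<psi> \<and> (\<forall>x\<in>M. blinfun_apply \<psi> (T x) = blinfun_apply \<phi> x)" using \<psi>(2) by blast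
  qed
  then obtain \<phi> where P: "\<And>n. P n (\<phi> n)"
    and step: "\<And>n x. x \<in> M \<Longrightarrow> blinfun_apply (\<phi> (Suc n)) (T x) = blinfun_apply (\<phi> n) x" by blast
  have \<phi>: "\<And>n. \<phi> n \<in> dual_space" "\<And>n. norm (\<phi> n) \<le> norm \<phi>0 * (2 * C) ^ n" "\<phi> 0 = \<phi>0"
    using P by (auto simp: P_def)
  have "2 * C > 0" using C by simp
  from dual_power_series[OF \<phi>(1,2) this]
  obtain f where f: "dual_analytic_on (ball 0 (1 / (2 * (2 * C)))) f"
      "\<And>l x. l \<in> ball 0 (1 / (2 * (2 * C))) \<Longrightarrow> (\<lambda>n. blinfun_apply (\<phi> n) x * l ^ n) sums blinfun_apply (f l) x"
    by blast
  show thesis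
  proof (rule that[of "1 / (2 * (2 * C))" f v])
    show r: "1 / (2 * (2 * C)) > 0" using C by simp
    show "blinfun_apply (f l) (shift T l x) = 0" if l: "l \<in> ball 0 (1 / (2 * (2 * C)))" and x: "x \<in> M" for l x
    proof -
      \<comment> \<open>Index shift: multiplying the series for f(l) x by l gives the series for
        f(l) (T x) without its term n = 0, and that term is \<phi>0 (T x) = 0. Hence f(l) (T x) = l
        f(l) x.\<close>
      have "(\<lambda>n. blinfun_apply (\<phi> (Suc n)) (T x) * l ^ Suc n) sums (l * blinfun_apply (f l) x)"
        using sums_mult[OF f(2)[OF l, of x], of l] by (simp add: step[OF x] mult_ac)
      from sums_Suc[OF this]
      have "(\<lambda>n. blinfun_apply (\<phi> n) (T x) * l ^ n) sums (l * blinfun_apply (f l) x)"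
        using \<phi>0(2) x by (simp add: \<phi>(3))
      then have "blinfun_apply (f l) (T x) = l * blinfun_apply (f l) x"
        using f(2)[OF l] sums_unique2 by blast
      moreover have "f l \<in> dual_space" using f(1) l unfolding dual_analytic_on_def by blast
      ultimately show ?thesis by (simp add: shift_def blinfun.diff_right dual_space_scaleC)
    qed
    have "blinfun_apply (f 0) v = blinfun_apply (\<phi> 0) v"
    proof (rule sums_unique2)
      show "(\<lambda>n. blinfun_apply (\<phi> n) v * 0 ^ n) sums blinfun_apply (f 0) v" using r by (intro f(2)) simp
      show "(\<lambda>n. blinfun_apply (\<phi> n) v * 0 ^ n) sums blinfun_apply (\<phi> 0) v" by (rule powser_sums_zero)
    qed
    then show "blinfun_apply (f 0) v \<noteq> 0" using \<phi>0(3) \<phi>(3) by simp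
  qed (use f v in auto)
qed

lemma dual_analytic_holomorphic:
  assumes "dual_analytic_on U f"
  shows "(\<lambda>l. blinfun_apply (f l) x) holomorphic_on U"
proof (rule holomorphic_onI)
  fix l assume "l \<in> U"
  then obtain g where "(f has_derivative (\<lambda>h. dscale h g)) (at l)"
    using assms unfolding dual_analytic_on_def by blast
  from bounded_linear.has_derivative[OF blinfun.bounded_linear_left this]
  have "((\<lambda>l. blinfun_apply (f l) x) has_field_derivative blinfun_apply g x) (at l)"
    unfolding has_field_derivative_def by (simp add: dscale_apply)
  then show "(\<lambda>l. blinfun_apply (f l) x) field_differentiable at l within U"
    using field_differentiable_at_within field_differentiable_def by blast
qed

text \<open>With A = T - l0 the annihilation condition reads f(l) (A x) = (l - l0) f(l) x, so each
  application of A contributes a zero at l0. The identity theorem carries the vanishing at l0 to all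
  of the connected set \<open>U\<close>; therefore descent at a single point, not necessarily the
  centre of a disc, is enough.\<close>

lemma finite_descent_functionals_vanish:
  assumes T: "bop T" and M: "cvec.subspace M" "T ` M \<subseteq> M"
    and d: "(shift T l0 ^^ d) ` M = (shift T l0 ^^ Suc d) ` M"
    and U: "open U" "connected U" "l0 \<in> U"
    and f: "dual_analytic_on U f"
    and ann: "\<And>l x. l \<in> U \<Longrightarrow> x \<in> M \<Longrightarrow> blinfun_apply (f l) (shift T l x) = 0"
    and x: "x \<in> M" and l: "l \<in> U"
  shows "blinfun_apply (f l) x = 0"
proof -
  define A where "A = shift T l0"
  have A: "bop A" and AM: "A ` M \<subseteq> M" unfolding A_def using bop_shift[OF T] shift_invariant[OF M] by auto
  have fA: "blinfun_apply (f l) (A x) = (l - l0) * blinfun_apply (f l) x" if l: "l \<in> U" and x: "x \<in> M" for l x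
  proof -
    have "f l \<in> dual_space" using f l unfolding dual_analytic_on_def by blast
    moreover have "A x = shift T l x + (l - l0) *\<^sub>C x"
      unfolding A_def shift_def by (simp add: cvec.scale_left_diff_distrib)
    ultimately show ?thesis using ann[OF l x] by (simp add: blinfun.add_right dual_space_scaleC)
  qed
  have hol: "(\<lambda>l. blinfun_apply (f l) x) holomorphic_on U" for x using dual_analytic_holomorphic[OF f] .
  define W where "W = (A ^^ d) ` M"
  have WM: "W \<subseteq> M" unfolding W_def using pow_invariant[OF AM] by blast
  have AW: "W = A ` W" unfolding W_def using d unfolding A_def pow_image_Suc .
  \<comment> \<open>Writing x = A y with y in \<open>W\<close>, the Leibniz rule for (l - l0) f(l) y
    leaves nothing at l0: the term i = 0 contains the factor l0 - l0, and the others contain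
    derivatives of order below n for y, again in \<open>W\<close>.\<close>
  have der0: "(deriv ^^ n) (\<lambda>l. blinfun_apply (f l) x) l0 = 0" if "x \<in> W" for n x
    using that
  proof (induction n arbitrary: x rule: less_induct)
    case (less n)
    obtain y where y: "y \<in> W" "x = A y" using less.prems AW by blast
    have "(deriv ^^ n) (\<lambda>l. blinfun_apply (f l) x) l0 = (deriv ^^ n) (\<lambda>l. (l - l0) * blinfun_apply (f l) y) l0"
    proof (rule higher_deriv_transform_within_open[OF _ _ U(1,3)])
      show "(\<lambda>l. (l - l0) * blinfun_apply (f l) y) holomorphic_on U" by (intro holomorphic_intros hol)
      show "blinfun_apply (f w) x = (w - l0) * blinfun_apply (f w) y" if "w \<in> U" for w
        using fA[OF that] y WM by blast
    qed (rule hol)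
    also have "\<dots> = (\<Sum>i=0..n. of_nat (n choose i) * (deriv ^^ i) (\<lambda>l. l - l0) l0 *
        (deriv ^^ (n - i)) (\<lambda>l. blinfun_apply (f l) y) l0)"
      by (rule higher_deriv_mult[OF _ hol U(1,3)]) (intro holomorphic_intros)
    also have "\<dots> = 0"
    proof (rule sum.neutral, rule ballI)
      fix i assume i: "i \<in> {0..n}"
      show "of_nat (n choose i) * (deriv ^^ i) (\<lambda>l. l - l0) l0 * (deriv ^^ (n - i)) (\<lambda>l. blinfun_apply (f l) y) l0 = 0"
      proof (cases "i = 0")
        case False
        then have "(deriv ^^ (n - i)) (\<lambda>l. blinfun_apply (f l) y) l0 = 0"
          using i by (intro less.IH y(1)) auto
        then show ?thesis by simp
      qed simp
    qed
    finally show ?case .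
  qed
  have W0: "blinfun_apply (f l) x = 0" if "x \<in> W" "l \<in> U" for x l
    using holomorphic_fun_eq_0_on_connected[OF hol U(1,2) der0[OF that(1)] U(3) that(2)] .
  \<comment> \<open>Return from \<open>W\<close> to M: A^d x lies in \<open>W\<close>, so (l - l0)^d
    f(l) x = 0. This settles l \<noteq> l0, and continuity settles l0.\<close>
  have "blinfun_apply (f l) ((A ^^ n) x) = (l - l0) ^ n * blinfun_apply (f l) x" if "l \<in> U" for n l
    by (induction n) (simp_all add: fA[OF that pow_invariant[OF AM x]])
  moreover have "(A ^^ d) x \<in> W" unfolding W_def using x by blast
  ultimately have off: "blinfun_apply (f l) x = 0" if "l \<in> U" "l \<noteq> l0" for l
    using W0[OF _ that(1)] that by (metis mult_eq_0_iff power_not_zero right_minus_eq)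
  have "isCont (\<lambda>l. blinfun_apply (f l) x) l0"
    using holomorphic_on_imp_continuous_on[OF hol] U continuous_on_eq_continuous_at by blast
  then have "((\<lambda>l. blinfun_apply (f l) x) \<longlongrightarrow> blinfun_apply (f l0) x) (at l0)" by (simp add: isCont_def)
  moreover have "((\<lambda>l. blinfun_apply (f l) x) \<longlongrightarrow> 0) (at l0)"
  proof (rule tendsto_eventually)
    show "\<forall>\<^sub>F l in at l0. blinfun_apply (f l) x = 0"
      using eventually_at_in_open[OF U(1,3)] by eventually_elim (use off in auto)
  qed
  ultimately have "blinfun_apply (f l0) x = 0" using tendsto_unique[OF at_neq_bot] by blast
  then show ?thesis using off l by blast
qed

section \<open>Riesz operators\<close>

lemma kerM_subspace: "bop A \<Longrightarrow> cvec.subspace N \<Longrightarrow> cvec.subspace (kerM A N)"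
  by (auto simp: kerM_def cvec.subspace_def bop_0 bop_add bop_scaleC)

text \<open>The intersections of the kernel with A^n N decrease inside a finite-dimensional space
  and become constant from some p on. From there the kernel of A on A^p N lies in every A^n (A^p N),
  while the ranges are closed by finite codimension. This brings the Kato construction within reach
  of Fredholm operators.\<close>

lemma fredholm_range_power_kato:
  fixes A :: "'a::{complex_normed_vector, banach} \<Rightarrow> 'a"
  assumes A: "bop A" and N: "cvec.subspace N" "closed N" "A ` N \<subseteq> N" and fred: "fredholm_on N A"
  obtains p where "closed ((A ^^ p) ` N)" "kato_on ((A ^^ p) ` N) A"
proof -
  have cod: "fin_codim_in N (A ` N)" and ker: "fin_cdim (kerM A N)" using fred by (simp_all add: fredholm_on_def)
  obtain F where F: "finite F" "kerM A N \<subseteq> cvec.span F" using ker unfolding fin_cdim_iff by blast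
  have Npow: "(A ^^ n) ` N \<subseteq> N" for n using pow_invariant[OF N(3)] by blast
  have cl: "closed ((A ^^ n) ` N)" for n
    by (rule closed_finite_codim_range[OF bop_pow[OF A] N(1,2) N(1,2) Npow fin_codim_pow[OF A N(1,3) cod]])
  define K where "K = (\<lambda>n. kerM A N \<inter> (A ^^ n) ` N)"
  have "\<exists>p. \<forall>n\<ge>p. K n = K p"
  proof (rule decreasing_subspaces_stable[OF _ _ F(1)])
    show "cvec.subspace (K n)" for n
      unfolding K_def by (intro cvec.subspace_inter kerM_subspace bop_subspace_image bop_pow A N(1))
    show "K n \<subseteq> K m" if "m \<le> n" for m n
      unfolding K_def using pow_image_antimono[OF N(3) that] by blast
    show "K 0 \<subseteq> cvec.span F" unfolding K_def using F(2) by blast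
  qed
  then obtain p where p: "\<And>n. n \<ge> p \<Longrightarrow> K n = K p" by blast
  show thesis
  proof (rule that[OF cl[of p]])
    have "kerM A ((A ^^ p) ` N) \<subseteq> (A ^^ n) ` (A ^^ p) ` N" for n
    proof -
      have "kerM A ((A ^^ p) ` N) \<subseteq> K p" using Npow unfolding K_def kerM_def by blast
      also have "\<dots> = K (n + p)" by (rule p[symmetric]) simp
      also have "\<dots> \<subseteq> (A ^^ n) ` (A ^^ p) ` N" unfolding K_def funpow_add image_comp by blast
      finally show ?thesis .
    qed
    moreover have "closed (A ` (A ^^ p) ` N)" using cl[of "Suc p"] unfolding pow_image_Suc .
    ultimately show "kato_on ((A ^^ p) ` N) A" by (simp add: kato_on_def)
  qed
qed

lemma shift_surj_large:
  fixes S :: "'a::{complex_normed_vector, banach} \<Rightarrow> 'a"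
  assumes S: "bop S" and N: "cvec.subspace N" "closed N" "S ` N \<subseteq> N"
  obtains l where "l \<noteq> 0" "shift S l ` N = N"
proof -
  obtain K where K: "K > 0" "\<And>x. norm (S x) \<le> norm x * K"
    using bounded_linear.pos_bounded[OF bop_bl[OF S]] by blast
  \<comment> \<open>For |l| = 2K the vector - y / l solves (S - l) x = y up to S y / l, whose norm
    is at most |y|/2.\<close>
  define l :: complex where "l = of_real (2 * K)"
  have l: "l \<noteq> 0" "cmod l = 2 * K" using K by (simp_all add: l_def norm_mult)
  have step: "\<exists>x\<in>N. norm x \<le> 1 / cmod l * norm y \<and> y - shift S l x \<in> N \<and> norm (y - shift S l x) \<le> 1/2 * norm y"
    if y: "y \<in> N" for y
  proof (intro bexI conjI)
    define x where "x = (- inverse l) *\<^sub>C y"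
    show xN: "(- inverse l) *\<^sub>C y \<in> N" using cvec.subspace_scale[OF N(1) y] .
    show "norm ((- inverse l) *\<^sub>C y) \<le> 1 / cmod l * norm y"
      by (simp add: norm_scaleC norm_inverse divide_inverse)
    have e: "y - shift S l ((- inverse l) *\<^sub>C y) = inverse l *\<^sub>C S y"
      unfolding shift_def bop_scaleC[OF S] using l(1) by simp
    show "y - shift S l ((- inverse l) *\<^sub>C y) \<in> N"
      unfolding e by (rule cvec.subspace_scale[OF N(1) subsetD[OF N(3) imageI[OF y]]])
    have "norm (inverse l *\<^sub>C S y) = norm (S y) / (2 * K)"
      by (simp only: norm_scaleC norm_inverse l(2) divide_inverse mult.commute)
    also have "\<dots> \<le> norm y * K / (2 * K)" using K by (intro divide_right_mono) auto
    finally show "norm (y - shift S l ((- inverse l) *\<^sub>C y)) \<le> 1/2 * norm y"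
      unfolding e using K(1) by simp
  qed
  have "y \<in> shift S l ` N" if y: "y \<in> N" for y
  proof -
    have "\<exists>x\<in>N. shift S l x = y \<and> norm x \<le> (1 / cmod l) / (1 - 1/2) * norm y"
      by (rule approx_surj_imp_surj[OF bop_bl[OF bop_shift[OF S, of l]] csubspace_imp_subspace[OF N(1)] N(2) _ _ _ step y]) simp_all
    then show ?thesis by blast
  qed
  then have "shift S l ` N = N" using shift_invariant[OF N(1,3)] by blast
  then show thesis using that l(1) by blast
qed

text \<open>On the closed subspace Y = A^d N the operator A is onto, hence so is A - m for small m.
  Modulo (A - m) N, A acts as multiplication by m, so A^d x is congruent to m^d x; as A^d x lies in
  Y = (A - m) Y, also m^d x is in the range, and m \<noteq> 0 can be divided out.\<close>

lemma finite_descent_punctured_surj: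
  fixes A :: "'a::{complex_normed_vector, banach} \<Rightarrow> 'a"
  assumes A: "bop A" and N: "cvec.subspace N" "closed N" "A ` N \<subseteq> N"
    and cod: "fin_codim_in N (A ` N)" and d: "(A ^^ d) ` N = (A ^^ Suc d) ` N"
  obtains e where "e > 0" "\<And>m. m \<noteq> 0 \<Longrightarrow> cmod m < e \<Longrightarrow> shift A m ` N = N"
proof -
  define Y where "Y = (A ^^ d) ` N"
  have YN: "Y \<subseteq> N" unfolding Y_def using pow_invariant[OF N(3)] by blast
  have Y: "cvec.subspace Y" "closed Y"
    unfolding Y_def using bop_subspace_image[OF bop_pow[OF A] N(1)]
      closed_finite_codim_range[OF bop_pow[OF A] N(1,2) N(1,2) _ fin_codim_pow[OF A N(1,3) cod]] YN Y_def by simp_all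
  have "A ` Y = Y" unfolding Y_def using d unfolding pow_image_Suc by (rule sym)
  then obtain e where e: "e > 0" "\<And>m. cmod m < e \<Longrightarrow> shift A m ` Y = Y"
    by (rule surj_perturbation[OF A Y]) (rule that)
  show thesis
  proof (rule that[OF e(1)])
    fix m :: complex assume m: "m \<noteq> 0" "cmod m < e"
    have R: "cvec.subspace (shift A m ` N)" by (rule bop_subspace_image[OF bop_shift[OF A] N(1)])
    have pow: "\<exists>z\<in>N. (A ^^ k) x = m ^ k *\<^sub>C x + shift A m z" if x: "x \<in> N" for k x
    proof (induction k)
      case 0
      show ?case using cvec.subspace_0[OF N(1)] by (intro bexI[of _ 0]) (simp_all add: bop_0[OF bop_shift[OF A]])
    next
      case (Suc k)
      then obtain z where z: "z \<in> N" "(A ^^ k) x = m ^ k *\<^sub>C x + shift A m z" by blast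
      have Ax: "A x = m *\<^sub>C x + shift A m x" by (simp add: shift_def)
      have "(A ^^ Suc k) x = m ^ k *\<^sub>C A x + A (shift A m z)" by (simp add: z(2) bop_add[OF A] bop_scaleC[OF A])
      also have "A (shift A m z) = shift A m (A z)" by (simp add: shift_def bop_diff[OF A] bop_scaleC[OF A])
      also have "m ^ k *\<^sub>C A x = m ^ Suc k *\<^sub>C x + shift A m (m ^ k *\<^sub>C x)"
        unfolding Ax bop_scaleC[OF bop_shift[OF A]] by (simp add: scaleC_add_right mult.commute)
      finally have "(A ^^ Suc k) x = m ^ Suc k *\<^sub>C x + shift A m (m ^ k *\<^sub>C x + A z)"
        by (simp add: bop_add[OF bop_shift[OF A]] add.assoc)
      moreover have "m ^ k *\<^sub>C x + A z \<in> N"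
        using x z(1) N(3) by (intro cvec.subspace_add[OF N(1)] cvec.subspace_scale[OF N(1)]) auto
      ultimately show ?case by blast
    qed
    have "x \<in> shift A m ` N" if x: "x \<in> N" for x
    proof -
      obtain z where z: "z \<in> N" "(A ^^ d) x = m ^ d *\<^sub>C x + shift A m z" using pow[OF x] by blast
      have "(A ^^ d) x \<in> shift A m ` Y" using e(2)[OF m(2)] x unfolding Y_def by blast
      then have "(A ^^ d) x - shift A m z \<in> shift A m ` N"
        using z(1) YN by (intro cvec.subspace_diff[OF R]) auto
      then have "m ^ d *\<^sub>C x \<in> shift A m ` N" by (simp add: z(2))
      from cvec.subspace_scale[OF R this, of "inverse (m ^ d)"] show ?thesis using m(1) by simp
    qed
    then show "shift A m ` N = N" using shift_invariant[OF N(1,3)] by blast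
  qed
qed

text \<open>The two sides are open for different reasons. Close to a point of finite descent the
  shifted operator is even onto. At a point l without it, S - l is Kato but not onto on some Y = (S
  - l)^p N; the functionals produced there do not vanish on Y, while finite descent at a nearby
  point would force them to.\<close>

lemma riesz_finite_descent:
  fixes S :: "'a::{complex_normed_vector, banach} \<Rightarrow> 'a"
  assumes S: "bop S" and N: "cvec.subspace N" "closed N" "S ` N \<subseteq> N" and riesz: "riesz_on N S" and l: "l \<noteq> 0"
  shows "\<exists>d. (shift S l ^^ d) ` N = (shift S l ^^ Suc d) ` N"
proof -
  define P where "P = (\<lambda>l. \<exists>d. (shift S l ^^ d) ` N = (shift S l ^^ Suc d) ` N)"
  have fred: "fredholm_on N (shift S l)" if "l \<noteq> 0" for l using riesz that by (simp add: riesz_on_def)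
  have bs: "bop (shift S l)" and inv: "shift S l ` N \<subseteq> N" for l
    using bop_shift[OF S] shift_invariant[OF N(1,3)] by blast+
  have surjP: "P l" if "shift S l ` N = N" for l
    unfolding P_def using that by (intro exI[of _ 0]) simp
  have near: "\<exists>r>0. \<forall>l'\<in>ball l r. P l' \<longleftrightarrow> P l" if l0: "l \<noteq> 0" for l
  proof (cases "P l")
    case True
    then obtain d where d: "(shift S l ^^ d) ` N = (shift S l ^^ Suc d) ` N" by (auto simp: P_def)
    have cod: "fin_codim_in N (shift S l ` N)" using fred[OF l0] by (simp add: fredholm_on_def)
    obtain e where e: "e > 0" "\<And>m. m \<noteq> 0 \<Longrightarrow> cmod m < e \<Longrightarrow> shift (shift S l) m ` N = N"
      by (rule finite_descent_punctured_surj[OF bs N(1,2) inv cod d]) (rule that)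
    show ?thesis
    proof (intro exI conjI ballI)
      fix l' assume l': "l' \<in> ball l e"
      show "P l' \<longleftrightarrow> P l"
      proof (cases "l' = l")
        case False
        then have "shift S (l + (l' - l)) ` N = N"
          using l' by (intro e(2)[unfolded shift_shift]) (auto simp: dist_norm norm_minus_commute)
        then show ?thesis using True surjP[of l'] by simp
      qed simp
    qed (rule e)
  next
    case False
    obtain p where p: "closed ((shift S l ^^ p) ` N)" "kato_on ((shift S l ^^ p) ` N) (shift S l)"
      by (rule fredholm_range_power_kato[OF bs N(1,2) inv fred[OF l0]]) (rule that)
    define Y where "Y = (shift S l ^^ p) ` N"
    have Y: "cvec.subspace Y" "closed Y" unfolding Y_def using bop_subspace_image[OF bop_pow[OF bs] N(1)] p(1) .
    have YY: "shift S l ` Y \<subseteq> Y"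
      unfolding Y_def pow_image_Suc[symmetric] by (rule pow_image_antimono[OF inv]) simp
    have nY: "shift S l ` Y \<noteq> Y"
    proof
      assume "shift S l ` Y = Y"
      then have "(shift S l ^^ p) ` N = (shift S l ^^ Suc p) ` N" unfolding Y_def pow_image_Suc by (rule sym)
      then show False using False unfolding P_def by blast
    qed
    obtain r f v where f: "r > 0" "dual_analytic_on (ball 0 r) f"
        "\<And>m x. m \<in> ball 0 r \<Longrightarrow> x \<in> Y \<Longrightarrow> blinfun_apply (f m) (shift (shift S l) m x) = 0"
        "v \<in> Y" "blinfun_apply (f 0) v \<noteq> 0"
      by (rule kato_not_surj_functionals[OF bs Y YY p(2)[folded Y_def] nY]) (rule that)
    have "\<not> P l'" if l': "l' \<in> ball l r" for l'
    proof
      assume "P l'"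
      then obtain d where d: "(shift S l' ^^ d) ` N = (shift S l' ^^ Suc d) ` N" by (auto simp: P_def)
      define m where "m = l' - l"
      have m: "m \<in> ball 0 r" "shift (shift S l) m = shift S l'"
        using l' unfolding m_def shift_shift by (auto simp: dist_norm norm_minus_commute)
      have "shift S l' (shift S l x) = shift S l (shift S l' x)" for x
        by (simp add: shift_def bop_diff[OF S] bop_scaleC[OF S] cvec.scale_right_diff_distrib mult.commute)
      \<comment> \<open>The shifts commute, so the powers of S - l' on Y are the images under (S -
        l)^p of those on N, and finite descent passes from N to Y.\<close>
      then have com: "(shift S l' ^^ k) ` Y = (shift S l ^^ p) ` (shift S l' ^^ k) ` N" for k
        unfolding Y_def image_image by (simp add: pow_commute)
      have "(shift (shift S l) m ^^ d) ` Y = (shift (shift S l) m ^^ Suc d) ` Y"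
        unfolding m(2) com d ..
      from finite_descent_functionals_vanish[OF bs Y(1) YY this open_ball connected_ball m(1) f(2,3,4)]
      show False using f(1,5) by simp
    qed
    then show ?thesis using f(1) False by blast
  qed
  have o1: "open {l. l \<noteq> 0 \<and> P l}" and o2: "open {l. l \<noteq> 0 \<and> \<not> P l}"
  proof -
    have *: "\<exists>r>0. \<forall>l'\<in>ball l r. l' \<noteq> 0 \<and> (P l' \<longleftrightarrow> P l)" if l0: "l \<noteq> 0" for l
    proof -
      obtain r where r: "r > 0" "\<forall>l'\<in>ball l r. P l' \<longleftrightarrow> P l" using near[OF l0] by blast
      have "0 \<notin> ball l (cmod l)" by (simp add: dist_norm)
      show ?thesis
      proof (intro exI conjI ballI)
        show "min r (cmod l) > 0" using r(1) l0 by simp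
        fix l' assume "l' \<in> ball l (min r (cmod l))"
        then have l': "l' \<in> ball l r" "l' \<in> ball l (cmod l)" by simp_all
        show "l' \<noteq> 0" using l'(2) \<open>0 \<notin> ball l (cmod l)\<close> by blast
        show "P l' \<longleftrightarrow> P l" using r(2) l'(1) by simp
      qed
    qed
    have "open {l. l \<noteq> 0 \<and> (P l \<longleftrightarrow> b)}" for b
    proof (rule open_subopen[THEN iffD2], rule ballI)
      fix l assume l: "l \<in> {l. l \<noteq> 0 \<and> (P l \<longleftrightarrow> b)}"
      then obtain r where r: "r > 0" "\<forall>l'\<in>ball l r. l' \<noteq> 0 \<and> (P l' \<longleftrightarrow> P l)" using * by blast
      have "ball l r \<subseteq> {l. l \<noteq> 0 \<and> (P l \<longleftrightarrow> b)}" using r(2) l unfolding subset_eq by simp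
      then show "\<exists>U. open U \<and> l \<in> U \<and> U \<subseteq> {l. l \<noteq> 0 \<and> (P l \<longleftrightarrow> b)}"
        using r(1) by (intro exI[of _ "ball l r"]) simp
    qed
    from this[of True] this[of False]
    show "open {l. l \<noteq> 0 \<and> P l}" "open {l. l \<noteq> 0 \<and> \<not> P l}" by simp_all
  qed
  have con: "connected (- {0::complex})" by (rule connected_punctured_universe) simp
  obtain l1 where l1: "l1 \<noteq> 0" "shift S l1 ` N = N"
    by (rule shift_surj_large[OF S N]) (rule that)
  have "{l. l \<noteq> 0 \<and> P l} \<inter> - {0} = {} \<or> {l. l \<noteq> 0 \<and> \<not> P l} \<inter> - {0} = {}"
    by (rule connectedD[OF con o1 o2]) auto
  then have "P l" using l1 surjP l by auto
  then show ?thesis by (simp add: P_def)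
qed

text \<open>Supplies, arbitrarily close to any non-zero l, points where the Riesz part is onto; l
  itself may be an exception.\<close>

lemma riesz_punctured_surj:
  fixes S :: "'a::{complex_normed_vector, banach} \<Rightarrow> 'a"
  assumes S: "bop S" and N: "cvec.subspace N" "closed N" "S ` N \<subseteq> N" and riesz: "riesz_on N S" and l: "l \<noteq> 0"
  obtains e where "e > 0" "\<And>m. m \<noteq> 0 \<Longrightarrow> cmod m < e \<Longrightarrow> shift S (l + m) ` N = N"
proof -
  obtain d where d: "(shift S l ^^ d) ` N = (shift S l ^^ Suc d) ` N"
    using riesz_finite_descent[OF assms] by blast
  have cod: "fin_codim_in N (shift S l ` N)" using riesz l by (simp add: riesz_on_def fredholm_on_def)
  show thesis
    by (rule finite_descent_punctured_surj[OF bop_shift[OF S] N(1,2) shift_invariant[OF N(1,3)] cod d])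
      (rule that[unfolded shift_shift[symmetric]])
qed

section \<open>Direct sum decompositions\<close>

text \<open>M is the sum of W = T^d M and the kernel of T^d, but these may meet, since the ascent is
  not controlled, and an arbitrary complement of W need not be invariant. Instead an invariant span
  of G independent of W is grown by single vectors. A set F of generators still missing measures
  progress: a pair (G, F) with the smallest F already gives all of M.\<close>

lemma finite_descent_splitting:
  assumes T: "bop T" and M: "cvec.subspace M" "T ` M \<subseteq> M"
    and cod: "fin_codim_in M (T ` M)" and d: "(T ^^ d) ` M = (T ^^ Suc d) ` M"
  obtains G where "finite G" "G \<subseteq> M" "T ` cvec.span G \<subseteq> cvec.span G"
    "(T ^^ d) ` M \<inter> cvec.span G = {0}" "M \<subseteq> cvec.span ((T ^^ d) ` M \<union> G)"
proof -
  define W where "W = (T ^^ d) ` M"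
  have W: "cvec.subspace W" "W \<subseteq> M"
    unfolding W_def using bop_subspace_image[OF bop_pow[OF T] M(1)] pow_invariant[OF M(2)] by blast+
  have TW: "W = T ` W" unfolding W_def using d unfolding pow_image_Suc .
  define good where "good = (\<lambda>G. finite G \<and> G \<subseteq> M \<and> T ` cvec.span G \<subseteq> cvec.span G \<and> W \<inter> cvec.span G = {0})"
  define gens where "gens = (\<lambda>G F. finite F \<and> M \<subseteq> cvec.span (W \<union> G \<union> F))"
  have "good {}" unfolding good_def using cvec.subspace_0[OF W(1)] by (auto simp: bop_0[OF T])
  moreover obtain F0 where "finite F0" "M \<subseteq> cvec.span (W \<union> F0)"
    using fin_codim_in_iff[OF W(1)] fin_codim_pow[OF T M cod, of d] unfolding W_def by blast
  ultimately have "good (fst ({}, F0)) \<and> gens (fst ({}, F0)) (snd ({}, F0))" by (simp add: gens_def)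
  then obtain p where p: "good (fst p) \<and> gens (fst p) (snd p)"
    and pmin: "\<forall>q. good (fst q) \<and> gens (fst q) (snd q) \<longrightarrow> card (snd p) \<le> card (snd q)"
    using ex_has_least_nat[of "\<lambda>p. good (fst p) \<and> gens (fst p) (snd p)" _ "\<lambda>p. card (snd p)"] by blast
  define G F where "G = fst p" and "F = snd p"
  have G: "good G" and F: "gens G F" and min: "\<And>G' F'. good G' \<Longrightarrow> gens G' F' \<Longrightarrow> card F \<le> card F'"
    using p pmin by (auto simp: G_def F_def)
  define Z where "Z = cvec.span (W \<union> G)"
  have Z: "cvec.subspace Z" "W \<subseteq> Z" "G \<subseteq> Z" unfolding Z_def using cvec.span_superset[of "W \<union> G"] by auto
  have "M \<subseteq> Z"
  proof (rule ccontr)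
    assume "\<not> M \<subseteq> Z"
    then obtain x where x: "x \<in> M" "x \<notin> Z" by blast
    have ex: "(T ^^ d) x \<in> Z" using x(1) Z(2) unfolding W_def by blast
    \<comment> \<open>Such k exists because T^d x is in \<open>W\<close>. The last iterate y outside
      \<open>Z\<close> satisfies T y \<in> Z, which is what keeps the enlarged span
      invariant.\<close>
    define k where "k = (LEAST k. (T ^^ k) x \<in> Z)"
    have k: "(T ^^ k) x \<in> Z" unfolding k_def using ex by (rule LeastI)
    then obtain j where j: "k = Suc j" using x(2) by (cases k) auto
    define y where "y = (T ^^ j) x"
    have "y \<notin> Z" unfolding y_def using not_less_Least[of j "\<lambda>k. (T ^^ k) x \<in> Z"] j k_def by simp
    have yM: "y \<in> M" unfolding y_def by (rule pow_invariant[OF M(2) x(1)])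
    have "T y \<in> Z" using k j by (simp add: y_def)
    then obtain w v where wv: "w \<in> W" "v \<in> cvec.span G" "T y = w + v"
      unfolding Z_def cvec.span_Un cvec.span_eq_iff[THEN iffD2, OF W(1)] by blast
    obtain w' where w': "w' \<in> W" "w = T w'" using wv(1) TW by blast
    \<comment> \<open>Since T W = W, y can be corrected within W so that T maps it into the span of G.\<close>
    define z where "z = y - w'"
    have Tz: "T z = v" using wv(3) w'(2) by (simp add: z_def bop_diff[OF T])
    have zZ: "z \<notin> Z"
    proof
      assume "z \<in> Z"
      then have "z + w' \<in> Z" using w'(1) Z(2) by (intro cvec.subspace_add[OF Z(1)]) auto
      then show False using \<open>y \<notin> Z\<close> by (simp add: z_def)
    qed
    have zM: "z \<in> M" unfolding z_def using yM w'(1) W(2) by (intro cvec.subspace_diff[OF M(1)]) auto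
    have sub: "cvec.span G \<subseteq> cvec.span (insert z G)" by (rule cvec.span_mono) blast
    have "good (insert z G)"
      unfolding good_def
    proof (intro conjI)
      show "finite (insert z G)" "insert z G \<subseteq> M" using G zM by (auto simp: good_def)
      have "T ` G \<subseteq> cvec.span G" using G cvec.span_superset[of G] unfolding good_def by blast
      then have "T ` insert z G \<subseteq> cvec.span (insert z G)" using sub wv(2) Tz by auto
      then show "T ` cvec.span (insert z G) \<subseteq> cvec.span (insert z G)"
        unfolding bop_span_image[OF T] by (rule cvec.span_minimal) simp
      have "u = 0" if u: "u \<in> W" "u \<in> cvec.span (insert z G)" for u
      proof -
        obtain c where c: "u - c *\<^sub>C z \<in> cvec.span G" using u(2) cvec.span_breakdown_eq by blast
        have "cvec.span G \<subseteq> Z" unfolding Z_def by (rule cvec.span_mono) blast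
        then have "u - (u - c *\<^sub>C z) \<in> Z" by (rule cvec.subspace_diff[OF Z(1) subsetD[OF Z(2) u(1)] subsetD[OF _ c]])
        then have "c *\<^sub>C z \<in> Z" by simp
        then have "inverse c *\<^sub>C (c *\<^sub>C z) \<in> Z" by (rule cvec.subspace_scale[OF Z(1)])
        then have "c = 0" using zZ by (cases "c = 0") auto
        then show ?thesis using c u(1) G unfolding good_def by auto
      qed
      then show "W \<inter> cvec.span (insert z G) = {0}"
        using cvec.subspace_0[OF W(1)] cvec.span_zero by blast
    qed
    \<comment> \<open>Since z is new modulo \<open>Z\<close>, it replaces one of the missing
      generators, against the minimality of \<open>F\<close>.\<close>
    moreover have "\<exists>a\<in>F. gens (insert z G) (F - {a})"
    proof -
      have fF: "finite F" and MF: "M \<subseteq> cvec.span (W \<union> G \<union> F)" using F by (auto simp: gens_def)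
      have "cvec.span (W \<union> G \<union> F) \<subseteq> cvec.span (Z \<union> F)" using Z by (intro cvec.span_mono) blast
      then have "z \<in> cvec.span (Z \<union> F)" using zM MF by blast
      then obtain a where a: "a \<in> F" "a \<in> cvec.span (insert z (Z \<union> (F - {a})))"
        using codim_exchange[OF fF Z(1) _ zZ] by blast
      define H where "H = cvec.span (W \<union> insert z G \<union> (F - {a}))"
      have H: "W \<union> insert z G \<union> (F - {a}) \<subseteq> H" unfolding H_def by (rule cvec.span_superset)
      have "Z \<subseteq> H" unfolding Z_def H_def by (rule cvec.span_mono) blast
      then have "cvec.span (insert z (Z \<union> (F - {a}))) \<subseteq> H"
        using H unfolding H_def by (intro cvec.span_minimal) auto
      then have "W \<union> G \<union> F \<subseteq> H" using H a by blast
      then have "cvec.span (W \<union> G \<union> F) \<subseteq> H" unfolding H_def by (rule cvec.span_minimal) simp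
      then show ?thesis using a(1) fF MF unfolding gens_def H_def by blast
    qed
    ultimately obtain a where a: "a \<in> F" "card F \<le> card (F - {a})" using min by blast
    then show False using F card_Diff1_less[of F a] by (simp add: gens_def)
  qed
  then show thesis using that[of G] G unfolding good_def W_def Z_def by blast
qed

text \<open>The projection onto N along M. It is bounded by the open mapping theorem for (m, n)
  \<mapsto> m + n, and it commutes with T by uniqueness of components and invariance of both
  summands.\<close>

lemma decomp_projection:
  fixes T :: "'a::{complex_normed_vector, banach} \<Rightarrow> 'a"
  assumes T: "bop T" and dec: "invariant_decomp T M N"
  obtains P where "bop P" "\<And>x. P x \<in> N" "\<And>x. x - P x \<in> M" "\<And>x. x \<in> N \<Longrightarrow> P x = x"
    "\<And>x. x \<in> M \<Longrightarrow> P x = 0" "\<And>x. P (T x) = T (P x)"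
proof -
  have M: "cvec.subspace M" "closed M" "T ` M \<subseteq> M" and N: "cvec.subspace N" "closed N" "T ` N \<subseteq> N"
    and MN: "M \<inter> N = {0}" and ex: "\<And>x. \<exists>m\<in>M. \<exists>n\<in>N. x = m + n"
    using dec by (auto simp: invariant_decomp_def csubspace_iff)
  have "\<exists>n\<in>N. x - n \<in> M" for x using ex[of x] by force
  then obtain P where P: "\<And>x. P x \<in> N" "\<And>x. x - P x \<in> M" by metis
  have uniq: "P x = n" if n: "n \<in> N" "x - n \<in> M" for x n
  proof -
    have "n - P x \<in> N" by (rule cvec.subspace_diff[OF N(1) n(1) P(1)])
    moreover have "(x - P x) - (x - n) \<in> M" by (rule cvec.subspace_diff[OF M(1) P(2) n(2)])
    then have "n - P x \<in> M" by simp
    ultimately have "n - P x = 0" using MN by blast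
    then show ?thesis by simp
  qed
  have add: "P (x + y) = P x + P y" for x y
  proof (rule uniq)
    show "P x + P y \<in> N" by (rule cvec.subspace_add[OF N(1) P(1) P(1)])
    have "(x - P x) + (y - P y) \<in> M" by (rule cvec.subspace_add[OF M(1) P(2) P(2)])
    then show "x + y - (P x + P y) \<in> M" by (simp add: algebra_simps)
  qed
  have sc: "P (c *\<^sub>C x) = c *\<^sub>C P x" for c x
  proof (rule uniq)
    show "c *\<^sub>C P x \<in> N" by (rule cvec.subspace_scale[OF N(1) P(1)])
    have "c *\<^sub>C (x - P x) \<in> M" by (rule cvec.subspace_scale[OF M(1) P(2)])
    then show "c *\<^sub>C x - c *\<^sub>C P x \<in> M" by (simp add: cvec.scale_right_diff_distrib)
  qed
  have PT: "P (T x) = T (P x)" for x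
  proof (rule uniq)
    show "T (P x) \<in> N" using P(1) N(3) by blast
    have "T (x - P x) \<in> M" using P(2) M(3) by blast
    then show "T x - T (P x) \<in> M" by (simp add: bop_diff[OF T])
  qed
  have UN: "{(\<lambda>x. x) m + n | m n. m \<in> M \<and> n \<in> N} = UNIV" using ex by fastforce
  then have cl: "closed {(\<lambda>x. x) m + n | m n. m \<in> M \<and> n \<in> N}" by (simp only: closed_UNIV)
  obtain C where C: "C > 0" "\<And>m n. m \<in> M \<Longrightarrow> n \<in> N \<Longrightarrow>
      \<exists>m'\<in>M. \<exists>n'\<in>N. m' + n' = m + n \<and> norm m' \<le> C * norm (m + n) \<and> norm n' \<le> C * norm (m + n)"
    by (rule sum_decomposition_bound[OF bounded_linear_ident csubspace_imp_subspace[OF M(1)] M(2)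
          csubspace_imp_subspace[OF N(1)] N(2) cl]) (rule that)
  have bd: "norm (P x) \<le> norm x * C" for x
  proof -
    obtain m' n' where "m' \<in> M" "n' \<in> N" "m' + n' = x - P x + P x" "norm n' \<le> C * norm (x - P x + P x)"
      using C(2)[OF P(2)[of x] P(1)[of x]] by blast
    moreover from this have "P x = n'" by (intro uniq) (auto simp: algebra_simps)
    ultimately show ?thesis by (simp add: mult.commute)
  qed
  have "bounded_linear P"
    using add sc bd by (intro bounded_linear_intro[of P C]) (simp_all add: scaleR_scaleC)
  then have "bop P" using sc by (simp add: bop_def)
  then show thesis
  proof (rule that[OF _ P])
    show "P x = x" if "x \<in> N" for x using that cvec.subspace_0[OF M(1)] by (intro uniq) auto
    show "P x = 0" if "x \<in> M" for x using that cvec.subspace_0[OF N(1)] by (intro uniq) auto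
  qed (rule PT)
qed

section \<open>Fredholm and semi-Browder properties of sums and summands\<close>

lemma fin_codim_in_sum:
  assumes A: "bop A" and M: "cvec.subspace M" "A ` M \<subseteq> M" and N: "cvec.subspace N" "A ` N \<subseteq> N"
    and cM: "fin_codim_in M (A ` M)" and cN: "fin_codim_in N (A ` N)"
    and Z: "cvec.subspace Z" "M \<subseteq> Z" "N \<subseteq> Z" "\<And>z. z \<in> Z \<Longrightarrow> \<exists>m\<in>M. \<exists>n\<in>N. z = m + n"
  shows "fin_codim_in Z (A ` Z)"
proof -
  obtain F where F: "finite F" "F \<subseteq> M" "M \<subseteq> cvec.span (A ` M \<union> F)"
    using fin_codim_in_iff[OF bop_subspace_image[OF A M(1)], THEN iffD1, OF cM] by blast
  obtain G where G: "finite G" "G \<subseteq> N" "N \<subseteq> cvec.span (A ` N \<union> G)"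
    using fin_codim_in_iff[OF bop_subspace_image[OF A N(1)], THEN iffD1, OF cN] by blast
  define H where "H = cvec.span (A ` Z \<union> (F \<union> G))"
  have "cvec.span (A ` M \<union> F) \<subseteq> H" "cvec.span (A ` N \<union> G) \<subseteq> H"
    unfolding H_def using Z(2,3) by (intro cvec.span_mono; blast)+
  then have MN: "M \<subseteq> H" "N \<subseteq> H" using F(3) G(3) by simp_all
  have "Z \<subseteq> H"
  proof
    fix z assume "z \<in> Z"
    then obtain m n where "m \<in> M" "n \<in> N" "z = m + n" using Z(4) by blast
    then show "z \<in> H" using MN cvec.span_add unfolding H_def by blast
  qed
  then show ?thesis
    unfolding fin_codim_in_iff[OF bop_subspace_image[OF A Z(1)]] H_def
    using F(1,2) G(1,2) Z(2,3) by (intro exI[of _ "F \<union> G"]) (simp, blast)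
qed

text \<open>The kernel splits along the sum: if A m + A n = 0, then A m = - A n lies in both M and N
  and is 0.\<close>

lemma fredholm_on_sum:
  assumes A: "bop A" and M: "cvec.subspace M" "A ` M \<subseteq> M" and N: "cvec.subspace N" "A ` N \<subseteq> N"
    and MN: "M \<inter> N = {0}" and fM: "fredholm_on M A" and fN: "fredholm_on N A"
    and Z: "cvec.subspace Z" "M \<subseteq> Z" "N \<subseteq> Z" "\<And>z. z \<in> Z \<Longrightarrow> \<exists>m\<in>M. \<exists>n\<in>N. z = m + n"
  shows "fredholm_on Z A"
  unfolding fredholm_on_def
proof
  show "fin_codim_in Z (A ` Z)"
    using fM fN unfolding fredholm_on_def by (intro fin_codim_in_sum[OF A M N _ _ Z]) simp_all
  obtain F where F: "finite F" "kerM A M \<subseteq> cvec.span F"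
    using fM unfolding fredholm_on_def fin_cdim_iff by blast
  obtain G where G: "finite G" "kerM A N \<subseteq> cvec.span G"
    using fN unfolding fredholm_on_def fin_cdim_iff by blast
  have sub: "cvec.span F \<subseteq> cvec.span (F \<union> G)" "cvec.span G \<subseteq> cvec.span (F \<union> G)"
    by (intro cvec.span_mono; blast)+
  show "fin_cdim (kerM A Z)"
  proof (rule fin_cdim_subset)
    show "kerM A Z \<subseteq> cvec.span (F \<union> G)"
    proof
      fix z assume z: "z \<in> kerM A Z"
      then obtain m n where mn: "m \<in> M" "n \<in> N" "z = m + n" using Z(4) unfolding kerM_def by blast
      have s: "A m + A n = 0" using z by (simp add: kerM_def mn(3) bop_add[OF A])
      have "A m \<in> M" using M(2) mn(1) by blast
      moreover have "- A n \<in> N" using N(2) mn(2) by (intro cvec.subspace_neg[OF N(1)]) blast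
      moreover have "A m = - A n" using s by (simp add: eq_neg_iff_add_eq_0)
      ultimately have "A m \<in> M \<inter> N" by simp
      then have "A m = 0" "A n = 0" using s unfolding MN by simp_all
      then have "m \<in> cvec.span F" "n \<in> cvec.span G" using mn F(2) G(2) by (auto simp: kerM_def)
      then show "z \<in> cvec.span (F \<union> G)" unfolding mn(3) using sub by (intro cvec.span_add) auto
    qed
  qed (use F(1) G(1) in simp)
qed

lemma fredholm_on_finite_span:
  assumes A: "bop A" and G: "finite G" "A ` cvec.span G \<subseteq> cvec.span G"
  shows "fredholm_on (cvec.span G) A"
  unfolding fredholm_on_def
proof
  show "fin_cdim (kerM A (cvec.span G))"
    by (rule fin_cdim_subset[OF G(1)]) (auto simp: kerM_def)
  have "cvec.span G \<subseteq> cvec.span (A ` cvec.span G \<union> G)" by (rule cvec.span_mono) blast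
  then show "fin_codim_in (cvec.span G) (A ` cvec.span G)"
    unfolding fin_codim_in_iff[OF bop_subspace_image[OF A cvec.subspace_span]]
    using G(1) cvec.span_superset by blast
qed

text \<open>Applying \<open>Q\<close> to the expansion of every vector by \<open>range A\<close> and
  \<open>F\<close> shows that Q F generates \<open>range Q\<close> modulo its image under A, because
  Q and A commute.\<close>

lemma fin_codim_in_summand:
  assumes A: "bop A" and Q: "bop Q" "\<And>x. A (Q x) = Q (A x)" and cod: "fin_codim_in UNIV (range A)"
  shows "fin_codim_in (range Q) (A ` range Q)"
proof -
  obtain F where F: "finite F" "UNIV \<subseteq> cvec.span (range A \<union> F)"
    using fin_codim_in_iff[OF bop_subspace_image[OF A cvec.subspace_UNIV], THEN iffD1, OF cod] by blast
  have "range Q \<subseteq> Q ` cvec.span (range A \<union> F)" using F(2) by blast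
  also have "\<dots> = cvec.span (Q ` range A \<union> Q ` F)" by (simp only: bop_span_image[OF Q(1)] image_Un)
  also have "Q ` range A = A ` range Q" unfolding image_image by (simp add: Q(2))
  finally show ?thesis
    unfolding fin_codim_in_iff[OF bop_subspace_image[OF A bop_subspace_image[OF Q(1) cvec.subspace_UNIV]]]
    using F(1) by (intro exI[of _ "Q ` F"]) auto
qed

lemma fredholm_on_summand:
  assumes A: "bop A" and Q: "bop Q" "\<And>x. A (Q x) = Q (A x)" and fred: "fredholm_on UNIV A"
  shows "fredholm_on (range Q) A"
  unfolding fredholm_on_def
proof
  show "fin_codim_in (range Q) (A ` range Q)"
    using fred unfolding fredholm_on_def by (intro fin_codim_in_summand[OF A Q]) simp
  obtain F where F: "finite F" "kerM A UNIV \<subseteq> cvec.span F"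
    using fred unfolding fredholm_on_def fin_cdim_iff by blast
  have "kerM A (range Q) \<subseteq> cvec.span F" using F(2) by (auto simp: kerM_def)
  then show "fin_cdim (kerM A (range Q))"
    by (rule fin_cdim_subset[OF F(1)])
qed

lemma descent_summand:
  fixes A :: "'a \<Rightarrow> 'a"
  assumes Q: "\<And>x. A (Q x) = Q (A x)" and d: "range (A ^^ d) = range (A ^^ Suc d)"
  shows "(A ^^ d) ` range Q = (A ^^ Suc d) ` range Q"
proof -
  have "(A ^^ n) ` range Q = Q ` range (A ^^ n)" for n
    unfolding image_image using pow_commute[of A Q n 1] Q by simp
  then show ?thesis by (simp only: d)
qed

lemma lower_semi_browder_on_summand:
  assumes A: "bop A" and Q: "bop Q" "\<And>x. A (Q x) = Q (A x)" and lsb: "lower_semi_browder_on UNIV A"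
  shows "lower_semi_browder_on (range Q) A"
  using lsb fin_codim_in_summand[OF A Q] descent_summand[of A Q, OF Q(2)]
  unfolding lower_semi_browder_on_def lower_semi_fredholm_on_def by blast

lemma lower_semi_browder_on_sum:
  assumes A: "bop A" and M: "cvec.subspace M" "A ` M \<subseteq> M" and N: "cvec.subspace N" "A ` N \<subseteq> N"
    and lM: "lower_semi_browder_on M A" and lN: "lower_semi_browder_on N A"
    and ex: "\<And>z. \<exists>m\<in>M. \<exists>n\<in>N. z = m + n"
  shows "lower_semi_browder_on UNIV A"
  unfolding lower_semi_browder_on_def lower_semi_fredholm_on_def
proof
  show "fin_codim_in UNIV (range A)"
    using lM lN unfolding lower_semi_browder_on_def lower_semi_fredholm_on_def
    by (intro fin_codim_in_sum[OF A M N _ _ cvec.subspace_UNIV _ _ ex]) simp_all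
  obtain d1 where d1: "(A ^^ d1) ` M = (A ^^ Suc d1) ` M" using lM unfolding lower_semi_browder_on_def by blast
  obtain d2 where d2: "(A ^^ d2) ` N = (A ^^ Suc d2) ` N" using lN unfolding lower_semi_browder_on_def by blast
  \<comment> \<open>Descent persists beyond the first index at which it occurs, so the maximum
    serves both summands.\<close>
  define d where "d = max d1 d2"
  have dM: "(A ^^ d) ` M = (A ^^ Suc d) ` M"
    using descent_stable[OF d1, of d] descent_stable[OF d1, of "Suc d"] by (simp add: d_def del: funpow.simps)
  have dN: "(A ^^ d) ` N = (A ^^ Suc d) ` N"
    using descent_stable[OF d2, of d] descent_stable[OF d2, of "Suc d"] by (simp add: d_def del: funpow.simps)
  have "(A ^^ d) z \<in> range (A ^^ Suc d)" for z
  proof -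
    obtain m n where mn: "m \<in> M" "n \<in> N" "z = m + n" using ex by blast
    have "(A ^^ d) m \<in> (A ^^ Suc d) ` M" "(A ^^ d) n \<in> (A ^^ Suc d) ` N" using mn dM dN by blast+
    then obtain m' n' where "(A ^^ d) m = (A ^^ Suc d) m'" "(A ^^ d) n = (A ^^ Suc d) n'" by blast
    then have "(A ^^ d) z = (A ^^ Suc d) (m' + n')" by (simp only: mn(3) bop_add[OF bop_pow[OF A]])
    then show ?thesis by blast
  qed
  moreover have "range (A ^^ Suc d) \<subseteq> range (A ^^ d)"
    by (rule pow_image_antimono) simp_all
  ultimately have "range (A ^^ d) = range (A ^^ Suc d)" by blast
  then show "\<exists>d. range (A ^^ d) = range (A ^^ Suc d)" ..
qed

lemma fredholm_on_cong:
  assumes "\<And>x. x \<in> M \<Longrightarrow> A x = B x"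
  shows "fredholm_on M A \<longleftrightarrow> fredholm_on M B"
proof -
  have "kerM A M = kerM B M" using assms by (auto simp: kerM_def)
  moreover have "A ` M = B ` M" using assms by (rule image_cong[OF refl])
  ultimately show ?thesis by (simp only: fredholm_on_def)
qed

lemma lower_semi_browder_on_cong:
  assumes eq: "\<And>x. x \<in> M \<Longrightarrow> A x = B x" and B: "B ` M \<subseteq> M"
  shows "lower_semi_browder_on M A \<longleftrightarrow> lower_semi_browder_on M B"
proof -
  have "(A ^^ n) x = (B ^^ n) x" if "x \<in> M" for n x
    by (induction n) (simp_all add: eq[OF pow_invariant[OF B that]])
  then have "(A ^^ n) ` M = (B ^^ n) ` M" for n by (intro image_cong) simp_all
  moreover have "A ` M = B ` M" using eq by (rule image_cong[OF refl])
  ultimately show ?thesis by (simp only: lower_semi_browder_on_def lower_semi_fredholm_on_def)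
qed

lemma surj_lower_semi_browder_on: "A ` M = M \<Longrightarrow> lower_semi_browder_on M A"
  unfolding lower_semi_browder_on_def lower_semi_fredholm_on_def fin_codim_in_def cspan_eq
  by (intro conjI exI[of _ "{}"] exI[of _ 0]) auto

lemma riesz_lower_semi_browder_on:
  fixes S :: "'a::{complex_normed_vector, banach} \<Rightarrow> 'a"
  assumes "bop S" "cvec.subspace N" "closed N" "S ` N \<subseteq> N" "riesz_on N S" "l \<noteq> 0"
  shows "lower_semi_browder_on N (shift S l)"
  using riesz_finite_descent[OF assms] assms(5,6)
  by (simp add: lower_semi_browder_on_def lower_semi_fredholm_on_def riesz_on_def fredholm_on_def)

section \<open>The equivalences\<close>

lemma invariant_decompD:
  assumes "invariant_decomp T M N"
  shows "cvec.subspace M" "closed M" "T ` M \<subseteq> M" "cvec.subspace N" "closed N" "T ` N \<subseteq> N"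
    "M \<inter> N = {0}" "\<exists>m\<in>M. \<exists>n\<in>N. x = m + n"
  using assms by (auto simp: invariant_decomp_def csubspace_iff)

lemma surj_kato_on:
  assumes "closed M" "T ` M = M"
  shows "kato_on M T"
proof -
  have "(T ^^ n) ` M = M" for n using descent_stable[of 0 T M n] assms(2) by simp
  then show ?thesis using assms by (auto simp: kato_on_def kerM_def)
qed

lemma lower_semi_browder_decomp_imp_surj:
  fixes T :: "'a::{complex_normed_vector, banach} \<Rightarrow> 'a"
  assumes T: "bop T" and dec: "invariant_decomp T M N"
    and lsb: "lower_semi_browder_on M T" and riesz: "riesz_on N T"
  shows "\<exists>M N. invariant_decomp T M N \<and> T ` M = M \<and> riesz_on N T"
proof -
  note D = invariant_decompD[OF dec]
  have cod: "fin_codim_in M (T ` M)"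
    using lsb by (simp add: lower_semi_browder_on_def lower_semi_fredholm_on_def)
  obtain d where d: "(T ^^ d) ` M = (T ^^ Suc d) ` M" using lsb by (auto simp: lower_semi_browder_on_def)
  obtain G where G: "finite G" "G \<subseteq> M" "T ` cvec.span G \<subseteq> cvec.span G"
      "(T ^^ d) ` M \<inter> cvec.span G = {0}" "M \<subseteq> cvec.span ((T ^^ d) ` M \<union> G)"
    by (rule finite_descent_splitting[OF T D(1,3) cod d]) (rule that)
  \<comment> \<open>\<open>W\<close> is the new surjective summand. The finite-dimensional remainder
    \<open>V\<close> of M moves to the other side, where \<open>Z\<close> is the sum of
    \<open>V\<close> and N; it stays closed because only finitely many vectors are added.\<close>
  define W V Z where "W = (T ^^ d) ` M" and "V = cvec.span G" and "Z = cvec.span (N \<union> G)"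
  have Wpow: "(T ^^ d) ` M \<subseteq> M" using pow_invariant[OF D(3)] by blast
  have W: "cvec.subspace W" "W \<subseteq> M" "closed W"
    unfolding W_def using bop_subspace_image[OF bop_pow[OF T] D(1)] Wpow
      closed_finite_codim_range[OF bop_pow[OF T] D(1,2) D(1,2) Wpow fin_codim_pow[OF T D(1,3) cod]] by simp_all
  have TW: "T ` W = W" unfolding W_def using d unfolding pow_image_Suc by (rule sym)
  have V: "cvec.subspace V" "V \<subseteq> M" "T ` V \<subseteq> V"
    unfolding V_def using G(3) cvec.span_minimal[OF G(2) D(1)] by simp_all
  have Z: "cvec.subspace Z" "closed Z" unfolding Z_def using closed_add_span[OF G(1) D(4,5)] by simp_all
  have Zsum: "z \<in> Z \<longleftrightarrow> (\<exists>v\<in>V. \<exists>n\<in>N. z = v + n)" for z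
  proof -
    have "Z = {v + n | v n. v \<in> V \<and> n \<in> N}"
      unfolding Z_def V_def Un_commute[of N] cvec.span_Un cvec.span_eq_iff[THEN iffD2, OF D(4)] ..
    then show ?thesis by blast
  qed
  have NV: "N \<subseteq> Z" "V \<subseteq> Z" unfolding Z_def V_def using cvec.span_superset[of "N \<union> G"] by (auto intro: cvec.span_mono[THEN subsetD])
  have "invariant_decomp T W Z"
    unfolding invariant_decomp_def csubspace_iff
  proof (intro conjI allI)
    show "T ` W \<subseteq> W" using TW by simp
    show "T ` Z \<subseteq> Z"
    proof
      fix y assume "y \<in> T ` Z"
      then obtain z where z: "z \<in> Z" "y = T z" by blast
      from Zsum[THEN iffD1, OF z(1)] obtain v n where vn: "v \<in> V" "n \<in> N" "y = T (v + n)" using z(2) by blast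
      then have "T v \<in> V" "T n \<in> N" using V(3) D(6) by blast+
      then show "y \<in> Z" unfolding Zsum vn(3) bop_add[OF T] by blast
    qed
    have "w = 0" if w: "w \<in> W" "w \<in> Z" for w
    proof -
      obtain v n where vn: "v \<in> V" "n \<in> N" "w = v + n" using Zsum[THEN iffD1, OF w(2)] by blast
      have "w - v \<in> M" using w(1) W(2) vn(1) V(2) by (intro cvec.subspace_diff[OF D(1)]) auto
      then have "n \<in> M \<inter> N" using vn by simp
      then have "w = v" unfolding D(7) using vn(3) by simp
      then have "w \<in> W \<inter> V" using w vn by simp
      then show ?thesis using G(4) unfolding W_def V_def by simp
    qed
    then show "W \<inter> Z = {0}" using cvec.subspace_0[OF W(1)] cvec.subspace_0[OF Z(1)] by auto
    show "\<exists>m\<in>W. \<exists>n\<in>Z. x = m + n" for x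
    proof -
      obtain m n where mn: "m \<in> M" "n \<in> N" "x = m + n" using D(8) by blast
      have "m \<in> cvec.span (W \<union> G)" using mn(1) G(5) unfolding W_def by blast
      then obtain w v where wv: "w \<in> W" "v \<in> V" "m = w + v"
        unfolding V_def cvec.span_Un cvec.span_eq_iff[THEN iffD2, OF W(1)] by blast
      have "v + n \<in> Z" unfolding Zsum using wv(2) mn(2) by blast
      moreover have "x = w + (v + n)" using mn(3) wv(3) by (simp add: add.assoc)
      ultimately show ?thesis using wv(1) by blast
    qed
  qed (use W Z in simp_all)
  moreover have "riesz_on Z T"
    unfolding riesz_on_def
  proof (intro allI impI)
    fix l :: complex assume l: "l \<noteq> 0"
    have VN: "V \<inter> N = {0}" using V(2) D(7) cvec.subspace_0[OF V(1)] cvec.subspace_0[OF D(4)] by blast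
    have "fredholm_on V (shift T l)"
      unfolding V_def using fredholm_on_finite_span[OF bop_shift[OF T] G(1)] shift_invariant[OF cvec.subspace_span G(3)] .
    moreover have "fredholm_on N (shift T l)" using riesz l by (simp add: riesz_on_def)
    ultimately show "fredholm_on Z (shift T l)"
      using fredholm_on_sum[OF bop_shift[OF T] V(1) shift_invariant[OF V(1,3)] D(4) shift_invariant[OF D(4,6)] VN _ _ Z(1) NV(2,1) Zsum[THEN iffD1]]
      by blast
  qed
  ultimately show ?thesis using TW by blast
qed

text \<open>\<open>vanish\<close> is applied to the projection Q onto the Kato summand M. Its
  premise then only concerns (T - l) M, where the functionals are known to vanish, and its
  conclusion contradicts f(0) v \<noteq> 0, because Q v = v.\<close>

lemma GKRD_imp_surj:
  fixes T :: "'a::{complex_normed_vector, banach} \<Rightarrow> 'a"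
  assumes T: "bop T" and gkrd: "GKRD T"
    and vanish: "\<And>r f Q. r > 0 \<Longrightarrow> dual_analytic_on (ball 0 r) f \<Longrightarrow> bop Q \<Longrightarrow> (\<And>x. Q (T x) = T (Q x)) \<Longrightarrow>
      (\<And>l x. l \<in> ball 0 r \<Longrightarrow> blinfun_apply (f l) (shift T l (Q x)) = 0) \<Longrightarrow> \<forall>x. blinfun_apply (f 0) (Q x) = 0"
  shows "\<exists>M N. invariant_decomp T M N \<and> T ` M = M \<and> riesz_on N T"
proof -
  obtain M N where dec: "invariant_decomp T M N" and kato: "kato_on M T" and riesz: "riesz_on N T"
    using gkrd by (auto simp: GKRD_def)
  note D = invariant_decompD[OF dec]
  obtain P where P: "bop P" "\<And>x. P x \<in> N" "\<And>x. x - P x \<in> M" "\<And>x. x \<in> N \<Longrightarrow> P x = x"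
      "\<And>x. x \<in> M \<Longrightarrow> P x = 0" "\<And>x. P (T x) = T (P x)"
    by (rule decomp_projection[OF T dec]) (rule that)
  define Q where "Q = (\<lambda>x. x - P x)"
  have Q: "bop Q" unfolding Q_def by (rule bop_minus[OF bop_ident P(1)])
  have QT: "Q (T x) = T (Q x)" for x by (simp add: Q_def P(6) bop_diff[OF T])
  have "T ` M = M"
  proof (rule ccontr)
    assume nM: "T ` M \<noteq> M"
    obtain r f v where f: "r > 0" "dual_analytic_on (ball 0 r) f"
        "\<And>l x. l \<in> ball 0 r \<Longrightarrow> x \<in> M \<Longrightarrow> blinfun_apply (f l) (shift T l x) = 0"
        "v \<in> M" "blinfun_apply (f 0) v \<noteq> 0"
      by (rule kato_not_surj_functionals[OF T D(1,2,3) kato nM]) (rule that)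
    have "\<forall>x. blinfun_apply (f 0) (Q x) = 0"
      by (rule vanish[OF f(1,2) Q QT f(3)]) (simp_all add: Q_def P(3))
    moreover have "Q v = v" using P(5)[OF f(4)] by (simp add: Q_def)
    ultimately show False using f(5) by metis
  qed
  then show ?thesis using dec riesz by blast
qed

lemma surj_decomp_imp_adjoint_svep:
  fixes T :: "'a::{complex_normed_vector, banach} \<Rightarrow> 'a"
  assumes T: "bop T" and dec: "invariant_decomp T M N" and surj: "T ` M = M" and riesz: "riesz_on N T"
  shows "adjoint_svep_at T 0"
  unfolding adjoint_svep_at_def
proof (intro allI impI ballI)
  fix r :: real and f :: "complex \<Rightarrow> 'a \<Rightarrow>\<^sub>L complex" and l :: complex
  assume r: "r > 0" and f: "dual_analytic_on (ball 0 r) f \<and> (\<forall>l\<in>ball 0 r. adjoint T (f l) - dscale l (f l) = 0)"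
    and l: "l \<in> ball 0 r"
  note D = invariant_decompD[OF dec]
  have ann: "blinfun_apply (f l) (shift T l x) = 0" if "l \<in> ball 0 r" for l x
  proof -
    have "blinfun_apply (adjoint T (f l) - dscale l (f l)) x = 0" using f that by simp
    then have "blinfun_apply (f l) (T x) = blinfun_apply (f l) x * l"
      by (simp add: blinfun.diff_left adjoint_def dscale_apply bounded_linear_Blinfun_apply[OF bop_bl[OF T]])
    moreover have "f l \<in> dual_space" using f that by (simp add: dual_analytic_on_def)
    ultimately show ?thesis by (simp add: shift_def blinfun.diff_right dual_space_scaleC)
  qed
  \<comment> \<open>On M descent occurs at l0 = 0 with d = 0, as T M = M.\<close>
  have fM: "blinfun_apply (f l) x = 0" if "x \<in> M" for x
  proof (rule finite_descent_functionals_vanish[OF T D(1,3) _ open_ball connected_ball _ conjunct1[OF f] ann that l])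
    show "(shift T 0 ^^ 0) ` M = (shift T 0 ^^ Suc 0) ` M" using surj by (simp add: shift_0)
  qed (use r in auto)
  \<comment> \<open>On N nothing is known about descent at 0, but any non-zero point of the disc has
    it; r/2 is one.\<close>
  have r2: "complex_of_real (r / 2) \<noteq> 0" "complex_of_real (r / 2) \<in> ball 0 r" using r by simp_all
  obtain d where d: "(shift T (of_real (r / 2)) ^^ d) ` N = (shift T (of_real (r / 2)) ^^ Suc d) ` N"
    using riesz_finite_descent[OF T D(4,5,6) riesz r2(1)] by blast
  have fN: "blinfun_apply (f l) x = 0" if "x \<in> N" for x
    by (rule finite_descent_functionals_vanish[OF T D(4,6) d open_ball connected_ball r2(2) conjunct1[OF f] ann that l])
  show "f l = 0"
  proof (rule blinfun_eqI)
    fix x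
    obtain m n where "m \<in> M" "n \<in> N" "x = m + n" using D(8) by blast
    then show "blinfun_apply (f l) x = blinfun_apply 0 x" using fM fN by (simp add: blinfun.add_right)
  qed
qed

lemma GKRD_adjoint_svep_imp_surj:
  fixes T :: "'a::{complex_normed_vector, banach} \<Rightarrow> 'a"
  assumes T: "bop T" and gkrd: "GKRD T" and svep: "adjoint_svep_at T 0"
  shows "\<exists>M N. invariant_decomp T M N \<and> T ` M = M \<and> riesz_on N T"
proof (rule GKRD_imp_surj[OF T gkrd])
  fix r :: real and f and Q :: "'a \<Rightarrow> 'a"
  assume r: "r > 0" and f: "dual_analytic_on (ball 0 r) f" and Q: "bop Q" and QT: "\<And>x. Q (T x) = T (Q x)"
    and ann: "\<And>l x. l \<in> ball 0 r \<Longrightarrow> blinfun_apply (f l) (shift T l (Q x)) = 0"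
  \<comment> \<open>Composition with \<open>Q\<close> makes the functionals annihilate all of (T -
    l) X, since Q commutes with T. So g(l) is in the kernel of T' - l, and the SVEP applies to
    it.\<close>
  define g where "g = (\<lambda>l. f l o\<^sub>L Blinfun Q)"
  have ga: "blinfun_apply (g l) x = blinfun_apply (f l) (Q x)" for l x
    by (simp add: g_def bounded_linear_Blinfun_apply[OF bop_bl[OF Q]])
  have fd: "f l \<in> dual_space" if "l \<in> ball 0 r" for l using f that by (simp add: dual_analytic_on_def)
  have "dual_analytic_on (ball 0 r) g"
    unfolding dual_analytic_on_def
  proof (intro conjI ballI)
    fix l :: complex assume l: "l \<in> ball 0 r"
    show "g l \<in> dual_space"
      unfolding dual_space_def by (simp add: ga bop_scaleC[OF Q] dual_space_scaleC[OF fd[OF l]])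
    obtain h where "(f has_derivative (\<lambda>z. dscale z h)) (at l)"
      using f l unfolding dual_analytic_on_def by blast
    from bounded_linear.has_derivative[OF bounded_bilinear.bounded_linear_left[OF bounded_bilinear_blinfun_compose] this]
    have "(g has_derivative (\<lambda>z. dscale z h o\<^sub>L Blinfun Q)) (at l)" unfolding g_def .
    moreover have "dscale z h o\<^sub>L Blinfun Q = dscale z (h o\<^sub>L Blinfun Q)" for z
      by (intro blinfun_eqI) (simp add: dscale_apply)
    ultimately show "\<exists>h. (g has_derivative (\<lambda>z. dscale z h)) (at l)" by auto
  qed
  moreover have "adjoint T (g l) - dscale l (g l) = 0" if l: "l \<in> ball 0 r" for l
  proof (rule blinfun_eqI)
    fix x
    have "blinfun_apply (f l) (T (Q x)) = l * blinfun_apply (f l) (Q x)"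
      using ann[OF l, of x] by (simp add: shift_def blinfun.diff_right dual_space_scaleC[OF fd[OF l]])
    then show "blinfun_apply (adjoint T (g l) - dscale l (g l)) x = blinfun_apply 0 x"
      by (simp add: blinfun.diff_left adjoint_def dscale_apply ga QT bounded_linear_Blinfun_apply[OF bop_bl[OF T]])
  qed
  ultimately have "\<forall>l\<in>ball 0 r. g l = 0" using svep r unfolding adjoint_svep_at_def by blast
  then have "g 0 = 0" using r by simp
  then show "\<forall>x. blinfun_apply (f 0) (Q x) = 0" by (simp flip: ga)
qed

lemma GKRD_interior_sigma_lsb_imp_surj:
  fixes T :: "'a::{complex_normed_vector, banach} \<Rightarrow> 'a"
  assumes T: "bop T" and gkrd: "GKRD T" and int: "0 \<notin> interior (sigma_lsb T)"
  shows "\<exists>M N. invariant_decomp T M N \<and> T ` M = M \<and> riesz_on N T"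
proof (rule GKRD_imp_surj[OF T gkrd], rule allI)
  fix r :: real and f and Q :: "'a \<Rightarrow> 'a" and x
  assume r: "r > 0" and f: "dual_analytic_on (ball 0 r) f" and Q: "bop Q" and QT: "\<And>x. Q (T x) = T (Q x)"
    and ann: "\<And>l x. l \<in> ball 0 r \<Longrightarrow> blinfun_apply (f l) (shift T l (Q x)) = 0"
  \<comment> \<open>One point of the disc outside the spectrum is enough: its finite descent on the
    whole space restricts to \<open>range Q\<close> and kills the family on the entire disc.\<close>
  have "\<not> ball 0 r \<subseteq> sigma_lsb T" using int r by (auto simp: mem_interior)
  then obtain l0 where l0: "l0 \<in> ball 0 r" "lower_semi_browder_on UNIV (shift T l0)"
    by (auto simp: sigma_lsb_def)
  then obtain d where d: "range (shift T l0 ^^ d) = range (shift T l0 ^^ Suc d)"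
    by (auto simp: lower_semi_browder_on_def simp del: funpow.simps)
  have "shift T l0 (Q x) = Q (shift T l0 x)" for x
    by (simp add: shift_def QT bop_diff[OF Q] bop_scaleC[OF Q])
  from descent_summand[of "shift T l0" Q, OF this d]
  have d': "(shift T l0 ^^ d) ` range Q = (shift T l0 ^^ Suc d) ` range Q" .
  have inv: "T ` range Q \<subseteq> range Q" by (auto simp flip: QT)
  show "blinfun_apply (f 0) (Q x) = 0"
    by (rule finite_descent_functionals_vanish[OF T bop_subspace_image[OF Q cvec.subspace_UNIV] inv d'
          open_ball connected_ball l0(1) f]) (use ann r in auto)
qed

text \<open>For small l \<noteq> 0 the shifted operator is onto on M and lower semi-Browder on N:
  the first by perturbation, the second because N is the Riesz summand.\<close>

lemma surj_decomp_imp_sigma_lsb_isolated: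
  fixes T :: "'a::{complex_normed_vector, banach} \<Rightarrow> 'a"
  assumes T: "bop T" and dec: "invariant_decomp T M N" and surj: "T ` M = M" and riesz: "riesz_on N T"
  shows "\<not> 0 islimpt sigma_lsb T"
proof -
  note D = invariant_decompD[OF dec]
  obtain e where e: "e > 0" "\<And>l. cmod l < e \<Longrightarrow> shift T l ` M = M"
    by (rule surj_perturbation[OF T D(1,2) surj]) (rule that)
  have "lower_semi_browder_on UNIV (shift T l)" if l: "l \<noteq> 0" "cmod l < e" for l
    by (rule lower_semi_browder_on_sum[OF bop_shift[OF T] D(1) shift_invariant[OF D(1,3)] D(4) shift_invariant[OF D(4,6)]
          surj_lower_semi_browder_on[OF e(2)[OF l(2)]] riesz_lower_semi_browder_on[OF T D(4,5,6) riesz l(1)] D(8)])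
  then show ?thesis using e(1) unfolding islimpt_approachable sigma_lsb_def by (auto simp: dist_norm)
qed

lemma surj_decomp_imp_interior_sigma_su:
  fixes T :: "'a::{complex_normed_vector, banach} \<Rightarrow> 'a"
  assumes T: "bop T" and dec: "invariant_decomp T M N" and surj: "T ` M = M" and riesz: "riesz_on N T"
  shows "0 \<notin> interior (sigma_su T)"
proof
  assume "0 \<in> interior (sigma_su T)"
  then obtain \<delta> where \<delta>: "\<delta> > 0" "ball 0 \<delta> \<subseteq> sigma_su T" by (auto simp: mem_interior)
  note D = invariant_decompD[OF dec]
  obtain e where e: "e > 0" "\<And>l. cmod l < e \<Longrightarrow> shift T l ` M = M"
    by (rule surj_perturbation[OF T D(1,2) surj]) (rule that)
  define t where "t = min e \<delta>"
  have t: "t > 0" "t \<le> e" "t \<le> \<delta>" using e(1) \<delta>(1) by (simp_all add: t_def)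
  \<comment> \<open>T - l0 is onto on M but perhaps not on N, so l0 is moved by a small m \<noteq> 0
    to a point where N is fine too. With |l0| = t/2 and |m| \<le> t/4 the sum stays within radius t,
    where M and the disc are still under control.\<close>
  define l0 where "l0 = complex_of_real (t / 2)"
  have l0: "l0 \<noteq> 0" "cmod l0 = t / 2" using t by (simp_all add: l0_def)
  obtain k where k: "k > 0" "\<And>m. m \<noteq> 0 \<Longrightarrow> cmod m < k \<Longrightarrow> shift T (l0 + m) ` N = N"
    by (rule riesz_punctured_surj[OF T D(4,5,6) riesz l0(1)]) (rule that)
  define m where "m = complex_of_real (min k t / 4)"
  have m: "m \<noteq> 0" "cmod m < k" "cmod m \<le> t / 4" using k(1) t(1) by (simp_all add: m_def)
  have l: "cmod (l0 + m) < t" using norm_triangle_ineq[of l0 m] l0(2) m(3) t(1) by simp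
  have "x \<in> range (shift T (l0 + m))" for x
  proof -
    obtain a b where ab: "a \<in> M" "b \<in> N" "x = a + b" using D(8) by blast
    have "a \<in> shift T (l0 + m) ` M" "b \<in> shift T (l0 + m) ` N"
      using e(2)[of "l0 + m"] k(2)[OF m(1,2)] l t(2) ab by simp_all
    then obtain a' b' where "a = shift T (l0 + m) a'" "b = shift T (l0 + m) b'" by blast
    then have "x = shift T (l0 + m) (a' + b')" using ab(3) by (simp only: bop_add[OF bop_shift[OF T]])
    then show ?thesis by blast
  qed
  then have "l0 + m \<notin> sigma_su T" by (auto simp: sigma_su_def)
  moreover have "l0 + m \<in> ball 0 \<delta>" using l t(3) by simp
  ultimately show False using \<delta>(2) by blast
qed

text \<open>P projects onto the Riesz summand N. Then T + P is T on M and T - (-1) on N, a shift by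
  a non-zero number; T P is 0 on M, so its shift by l \<noteq> 0 is invertible there, and T P is T
  on N.\<close>

lemma surj_decomp_imp_projection:
  fixes T :: "'a::{complex_normed_vector, banach} \<Rightarrow> 'a"
  assumes T: "bop T" and dec: "invariant_decomp T M N" and surj: "T ` M = M" and riesz: "riesz_on N T"
  shows "\<exists>P. bop P \<and> P \<circ> P = P \<and> P \<circ> T = T \<circ> P \<and>
           lower_semi_browder_on UNIV (\<lambda>x. T x + P x) \<and> riesz_on UNIV (T \<circ> P)"
proof -
  note D = invariant_decompD[OF dec]
  obtain P where P: "bop P" "\<And>x. P x \<in> N" "\<And>x. x - P x \<in> M" "\<And>x. x \<in> N \<Longrightarrow> P x = x"
      "\<And>x. x \<in> M \<Longrightarrow> P x = 0" "\<And>x. P (T x) = T (P x)"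
    by (rule decomp_projection[OF T dec]) (rule that)
  have A: "bop (\<lambda>x. T x + P x)" by (rule bop_plus[OF T P(1)])
  have iM: "(\<lambda>x. T x + P x) ` M \<subseteq> M" using D(3) by (auto simp: P(5))
  have iN: "(\<lambda>x. T x + P x) ` N \<subseteq> N" using D(6) by (auto simp: P(4) intro!: cvec.subspace_add[OF D(4)])
  have "lower_semi_browder_on M (\<lambda>x. T x + P x)"
    using surj by (intro surj_lower_semi_browder_on) (simp add: P(5) cong: image_cong)
  moreover have "lower_semi_browder_on N (\<lambda>x. T x + P x)"
  proof -
    have "lower_semi_browder_on N (shift T (- 1))"
      by (rule riesz_lower_semi_browder_on[OF T D(4,5,6) riesz]) simp
    moreover have "lower_semi_browder_on N (\<lambda>x. T x + P x) \<longleftrightarrow> lower_semi_browder_on N (shift T (- 1))"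
      by (rule lower_semi_browder_on_cong[OF _ shift_invariant[OF D(4,6)]]) (simp add: P(4) shift_def)
    ultimately show ?thesis by simp
  qed
  ultimately have "lower_semi_browder_on UNIV (\<lambda>x. T x + P x)"
    by (rule lower_semi_browder_on_sum[OF A D(1) iM D(4) iN _ _ D(8)])
  moreover have "riesz_on UNIV (T \<circ> P)"
    unfolding riesz_on_def
  proof (intro allI impI)
    fix l :: complex assume l: "l \<noteq> 0"
    have B: "bop (shift (T \<circ> P) l)" by (rule bop_shift[OF bop_compose[OF T P(1)]])
    have BM: "shift (T \<circ> P) l x = (- l) *\<^sub>C x" if "x \<in> M" for x
      using that by (simp add: shift_def P(5) bop_0[OF T])
    have BN: "shift (T \<circ> P) l x = shift T l x" if "x \<in> N" for x
      using that by (simp add: shift_def P(4))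
    have iM: "shift (T \<circ> P) l ` M \<subseteq> M" using cvec.subspace_scale[OF D(1)] by (simp add: BM image_subset_iff del: cvec.scale_minus_left)
    have iN: "shift (T \<circ> P) l ` N \<subseteq> N" using BN shift_invariant[OF D(4,6)] by (simp cong: image_cong)
    have "fredholm_on M (shift (T \<circ> P) l)"
    proof -
      have "kerM (shift (T \<circ> P) l) M \<subseteq> {0}" using BM l by (auto simp: kerM_def)
      then have "fin_cdim (kerM (shift (T \<circ> P) l) M)" by (intro fin_cdim_subset[of "{}"]) auto
      moreover have "x \<in> shift (T \<circ> P) l ` M" if x: "x \<in> M" for x
      proof
        show "inverse (- l) *\<^sub>C x \<in> M" by (rule cvec.subspace_scale[OF D(1) x])
        then show "x = shift (T \<circ> P) l (inverse (- l) *\<^sub>C x)" using l by (simp only: BM) simp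
      qed
      then have "shift (T \<circ> P) l ` M = M" using iM by blast
      then have "fin_codim_in M (shift (T \<circ> P) l ` M)"
        using surj_lower_semi_browder_on unfolding lower_semi_browder_on_def lower_semi_fredholm_on_def by blast
      ultimately show ?thesis by (simp add: fredholm_on_def)
    qed
    moreover have "fredholm_on N (shift (T \<circ> P) l)"
      using riesz l fredholm_on_cong[OF BN] by (simp add: riesz_on_def)
    ultimately show "fredholm_on UNIV (shift (T \<circ> P) l)"
      by (rule fredholm_on_sum[OF B D(1) iM D(4) iN D(7) _ _ cvec.subspace_UNIV _ _ D(8)]) simp_all
  qed
  moreover have "P \<circ> P = P" "P \<circ> T = T \<circ> P" using P(2,4,6) by (auto simp: fun_eq_iff)
  ultimately show ?thesis using P(1) by blast
qed

text \<open>The summands are the kernel and the range of P, with T + P = T on the first and T P = T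
  on the second. Each is written both as a range, for restricting the properties, and as a kernel,
  for closedness.\<close>

lemma projection_imp_lower_semi_browder_decomp:
  fixes T :: "'a::{complex_normed_vector, banach} \<Rightarrow> 'a"
  assumes T: "bop T" and P: "bop P" "P \<circ> P = P" "P \<circ> T = T \<circ> P"
    and lsb: "lower_semi_browder_on UNIV (\<lambda>x. T x + P x)" and riesz: "riesz_on UNIV (T \<circ> P)"
  shows "\<exists>M N. invariant_decomp T M N \<and> lower_semi_browder_on M T \<and> riesz_on N T"
proof -
  have PP: "P (P x) = P x" and PT: "P (T x) = T (P x)" for x
    using P(2,3) by (simp_all add: fun_eq_iff)
  define Q where "Q = (\<lambda>x. x - P x)"
  have Q: "bop Q" unfolding Q_def by (rule bop_minus[OF bop_ident P(1)])
  have PQ: "P (Q x) = 0" for x by (simp add: Q_def bop_diff[OF P(1)] PP)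
  have QT: "Q (T x) = T (Q x)" for x by (simp add: Q_def PT bop_diff[OF T])
  have rQ: "range Q = {x. P x = 0}"
  proof (intro set_eqI iffI)
    fix x assume "x \<in> {x. P x = 0}"
    then have "Q x = x" by (simp add: Q_def)
    then show "x \<in> range Q" by (rule range_eqI[OF sym])
  qed (auto simp: PQ)
  have rP: "range P = {x. Q x = 0}"
  proof (intro set_eqI iffI)
    fix x assume "x \<in> {x. Q x = 0}"
    then have "x = P x" by (simp add: Q_def)
    then show "x \<in> range P" by (rule range_eqI)
  qed (auto simp: Q_def PP)
  have clos: "closed {x. R x = 0}" if "bop R" for R :: "'a \<Rightarrow> 'a"
    by (intro closed_Collect_eq continuous_on_const bounded_linear.continuous_on[OF bop_bl[OF that]] continuous_on_id)
  have iQ: "T ` range Q \<subseteq> range Q" and iP: "T ` range P \<subseteq> range P"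
    by (auto simp flip: QT PT)
  have "invariant_decomp T (range Q) (range P)"
    unfolding invariant_decomp_def csubspace_iff
  proof (intro conjI allI)
    show "closed (range Q)" "closed (range P)" unfolding rQ rP using clos P(1) Q by simp_all
    show "range Q \<inter> range P = {0}"
      unfolding rQ using PP bop_0[OF P(1)] by auto
    show "\<exists>m\<in>range Q. \<exists>n\<in>range P. x = m + n" for x
      by (intro bexI[of _ "Q x"] bexI[of _ "P x"]) (simp_all add: Q_def)
  qed (use iQ iP bop_subspace_image[OF Q cvec.subspace_UNIV] bop_subspace_image[OF P(1) cvec.subspace_UNIV] in simp_all)
  moreover have "lower_semi_browder_on (range Q) T"
  proof -
    have "T (Q x) + P (Q x) = Q (T x + P x)" for x
      by (simp add: PQ bop_add[OF Q] QT) (simp add: Q_def PP)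
    then have "lower_semi_browder_on (range Q) (\<lambda>x. T x + P x)"
      by (rule lower_semi_browder_on_summand[OF bop_plus[OF T P(1)] Q _ lsb])
    moreover have "lower_semi_browder_on (range Q) (\<lambda>x. T x + P x) \<longleftrightarrow> lower_semi_browder_on (range Q) T"
      by (rule lower_semi_browder_on_cong[OF _ iQ]) (auto simp: PQ)
    ultimately show ?thesis by simp
  qed
  moreover have "riesz_on (range P) T"
    unfolding riesz_on_def
  proof (intro allI impI)
    fix l :: complex assume l: "l \<noteq> 0"
    have "shift (T \<circ> P) l (P x) = P (shift (T \<circ> P) l x)" for x
      by (simp add: shift_def bop_diff[OF P(1)] bop_scaleC[OF P(1)] PT)
    then have "fredholm_on (range P) (shift (T \<circ> P) l)"
      using riesz l unfolding riesz_on_def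
      by (intro fredholm_on_summand[OF bop_shift[OF bop_compose[OF T P(1)]] P(1)]) simp_all
    moreover have "fredholm_on (range P) (shift (T \<circ> P) l) \<longleftrightarrow> fredholm_on (range P) (shift T l)"
      by (rule fredholm_on_cong) (auto simp: shift_def PP)
    ultimately show "fredholm_on (range P) (shift T l)" by simp
  qed
  ultimately show ?thesis by blast
qed

theorem theorem2p8:
  fixes T :: "'a::{complex_normed_vector, banach} \<Rightarrow> 'a"
  assumes "\<not> fin_cdim (UNIV :: 'a set)"
    and "bop T"
  shows
    "((\<exists>M N. invariant_decomp T M N \<and> T ` M = M \<and> riesz_on N T) \<longleftrightarrow>
      (GKRD T \<and> 0 \<notin> interior (sigma_su T))) \<and>
     ((GKRD T \<and> 0 \<notin> interior (sigma_su T)) \<longleftrightarrow>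
      (GKRD T \<and> adjoint_svep_at T 0)) \<and>
     ((GKRD T \<and> adjoint_svep_at T 0) \<longleftrightarrow>
      (\<exists>M N. invariant_decomp T M N \<and> lower_semi_browder_on M T \<and> riesz_on N T)) \<and>
     ((\<exists>M N. invariant_decomp T M N \<and> lower_semi_browder_on M T \<and> riesz_on N T) \<longleftrightarrow>
      (GKRD T \<and> \<not> (0 islimpt sigma_lsb T))) \<and>
     ((GKRD T \<and> \<not> (0 islimpt sigma_lsb T)) \<longleftrightarrow>
      (GKRD T \<and> 0 \<notin> interior (sigma_lsb T))) \<and>
     ((GKRD T \<and> 0 \<notin> interior (sigma_lsb T)) \<longleftrightarrow>
      (\<exists>P. bop P \<and> P \<circ> P = P \<and> P \<circ> T = T \<circ> P \<and>
           lower_semi_browder_on UNIV (\<lambda>x. T x + P x) \<and> riesz_on UNIV (T \<circ> P)))"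
proof -
  define I where "I = (\<exists>M N. invariant_decomp T M N \<and> T ` M = M \<and> riesz_on N T)"
  have T: "bop T" by fact
  \<comment> \<open>A surjective shift is lower semi-Browder, so 0 outside the interior of the
    larger spectrum is also outside that of the smaller one.\<close>
  have "sigma_lsb T \<subseteq> sigma_su T"
    unfolding sigma_lsb_def sigma_su_def using surj_lower_semi_browder_on by blast
  then have int: "interior (sigma_lsb T) \<subseteq> interior (sigma_su T)" by (rule interior_mono)
  have dec: "GKRD T" "0 \<notin> interior (sigma_su T)" "\<not> 0 islimpt sigma_lsb T" "adjoint_svep_at T 0"
      "\<exists>M N. invariant_decomp T M N \<and> lower_semi_browder_on M T \<and> riesz_on N T"
      "\<exists>P. bop P \<and> P \<circ> P = P \<and> P \<circ> T = T \<circ> P \<and>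
           lower_semi_browder_on UNIV (\<lambda>x. T x + P x) \<and> riesz_on UNIV (T \<circ> P)" if I
  proof -
    obtain M N where MN: "invariant_decomp T M N" "T ` M = M" "riesz_on N T" using \<open>I\<close> unfolding I_def by blast
    show "GKRD T" unfolding GKRD_def using MN surj_kato_on[OF invariant_decompD(2)[OF MN(1)] MN(2)] by blast
    show "\<exists>M N. invariant_decomp T M N \<and> lower_semi_browder_on M T \<and> riesz_on N T"
      using MN surj_lower_semi_browder_on[OF MN(2)] by blast
    show "0 \<notin> interior (sigma_su T)" by (rule surj_decomp_imp_interior_sigma_su[OF T MN])
    show "\<not> 0 islimpt sigma_lsb T" by (rule surj_decomp_imp_sigma_lsb_isolated[OF T MN])
    show "adjoint_svep_at T 0" by (rule surj_decomp_imp_adjoint_svep[OF T MN])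
    show "\<exists>P. bop P \<and> P \<circ> P = P \<and> P \<circ> T = T \<circ> P \<and>
           lower_semi_browder_on UNIV (\<lambda>x. T x + P x) \<and> riesz_on UNIV (T \<circ> P)"
      by (rule surj_decomp_imp_projection[OF T MN])
  qed
  have lsb: I if "\<exists>M N. invariant_decomp T M N \<and> lower_semi_browder_on M T \<and> riesz_on N T"
    using that lower_semi_browder_decomp_imp_surj[OF T] unfolding I_def by blast
  have int_lsb: I if "GKRD T" "0 \<notin> interior (sigma_lsb T)"
    using GKRD_interior_sigma_lsb_imp_surj[OF T that] unfolding I_def .
  \<comment> \<open>The complex plane has no isolated points, so every interior point is an
    accumulation point.\<close>
  have acc: "0 \<notin> interior (sigma_lsb T)" if "\<not> 0 islimpt sigma_lsb T"
    using that interior_limit_point by blast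
  have svep: I if "GKRD T" "adjoint_svep_at T 0"
    using GKRD_adjoint_svep_imp_surj[OF T that] unfolding I_def .
  have proj: I if ex: "\<exists>P. bop P \<and> P \<circ> P = P \<and> P \<circ> T = T \<circ> P \<and>
           lower_semi_browder_on UNIV (\<lambda>x. T x + P x) \<and> riesz_on UNIV (T \<circ> P)"
  proof -
    obtain P where P: "bop P" "P \<circ> P = P" "P \<circ> T = T \<circ> P"
        "lower_semi_browder_on UNIV (\<lambda>x. T x + P x)" "riesz_on UNIV (T \<circ> P)" using ex by blast
    show I by (rule lsb[OF projection_imp_lower_semi_browder_decomp[OF T P]])
  qed
  have "I \<longleftrightarrow> GKRD T \<and> 0 \<notin> interior (sigma_su T)" using dec(1,2) int int_lsb by blast
  moreover have "I \<longleftrightarrow> GKRD T \<and> adjoint_svep_at T 0" using dec(1,4) svep by blast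
  moreover have "I \<longleftrightarrow> (\<exists>M N. invariant_decomp T M N \<and> lower_semi_browder_on M T \<and> riesz_on N T)"
    using dec(5) lsb by (rule iffI)
  moreover have "I \<longleftrightarrow> GKRD T \<and> \<not> 0 islimpt sigma_lsb T" using dec(1,3) acc int_lsb by blast
  moreover have "I \<longleftrightarrow> GKRD T \<and> 0 \<notin> interior (sigma_lsb T)" using dec(1,3) acc int_lsb by blast
  moreover have "I \<longleftrightarrow> (\<exists>P. bop P \<and> P \<circ> P = P \<and> P \<circ> T = T \<circ> P \<and>
           lower_semi_browder_on UNIV (\<lambda>x. T x + P x) \<and> riesz_on UNIV (T \<circ> P))"
    using dec(6) proj by (rule iffI)
  ultimately show ?thesis unfolding I_def[symmetric] by (simp only:)
qed

end
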